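(* Let $\boldsymbol\theta=(\theta_1,\dots,\theta_m)\in\mathbb{R}^m$ be the true parameter, let $(\hat{\boldsymbol\theta}_n)_{n\ge1}$ be a sequence of $\mathbb{R}^m$-valued estimators of $\boldsymbol\theta$, and let $R_{\boldsymbol\theta}$ be the surrogate reward function. Suppose that the estimators satisfy: - $\|\mathbb{E}[\hat{\boldsymbol\theta}_n-\boldsymbol\theta]\|_\infty=o(n^{-1})$; - $\Sigma_n:=\mathbb{E}[(\hat{\boldsymbol\theta}_n-\boldsymbol\theta)(\hat{\boldsymbol\theta}_n-\boldsymbol\theta)^\top]$ satisfies $\lim_{n\to\infty}n\Sigma_n=\Sigma_\theta$; - $\mathbb{E}\left[\|(\hat{\boldsymbol\theta}_n-\boldsymbol\theta)^{\otimes k}\|_{\max}\right]=O(n^{-k/2})$ for all integers $k\ge3$. Suppose also that the surrogate reward satisfies: - the gradient of $R_{\boldsymbol\theta}(\cdot)$ at $\boldsymbol\theta$ is $\mathbf{0}$; - there exists a matrix $M_\theta\in\mathbb{R}^{m\times m}$ such that for every diagonal matrix $\Lambda\in\mathbb{R}^{m\times m}$, $$\langle H_{\boldsymbol\theta},\Lambda M_\theta\rangle=\langle\nabla^3R_{\boldsymbol\theta}(\boldsymbol\theta),(\Lambda\boldsymbol\theta)\otimes\Sigma_\theta\rangle;$$ - $\|\nabla^5R_{\boldsymbol\theta}(\cdot)\|_{\max}$ is uniformly bounded (in particular $R_{\boldsymbol\theta}$ is five times differentiable). For a diagonal adjustment matrix $\Lambda=\mathrm{diag}(\boldsymbol\lambda)$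 with $\boldsymbol\lambda\in\mathbb{R}^m$, the asymptotic improvement in expected reward is a quadratic function of $\boldsymbol\lambda$: $$\lim_{n\to\infty} n^2\left(\mathbb{E}\left[R_{\boldsymbol\theta}\left((\mathbb{I}+\Lambda/n)\hat{\boldsymbol\theta}_n\right)\right]-\mathbb{E}\left[R_{\boldsymbol\theta}(\hat{\boldsymbol\theta}_n)\right]\right)=\frac12\left(\boldsymbol\lambda^\top A(\boldsymbol\theta)\boldsymbol\lambda+b(\boldsymbol\theta)^\top\boldsymbol\lambda\right),$$ where $A(\boldsymbol\theta)\in\mathbb{R}^{m\times m}$ and $b(\boldsymbol\theta)\in\mathbb{R}^m$ are given by $$A(\boldsymbol\theta)_{ij}=(H_{\boldsymbol\theta})_{ij}\,\theta_i\theta_j,\qquad b(\boldsymbol\theta)=\left(H_{\boldsymbol\theta}\odot(2\Sigma_\theta+M_\theta)\right)\mathbf{1}_m.$$ If $A(\boldsymbol\theta)$ is negative definite, the unique optimal adjustment (the unique maximizer over $\boldsymbol\lambda\in\mathbb{R}^m$ of this asymptotic improvement) is $\boldsymbol\lambda^\ast=-\frac12A(\boldsymbol\theta)^{-1}b(\boldsymbol\theta)$.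
   Context: $\hat{\boldsymbol\theta}_n$ is an estimator of $\boldsymbol\theta\in\mathbb{R}^m$ computed from a sample of size $n$; expectations are over its sampling distribution. $R_{\boldsymbol\theta}(\cdot):\mathbb{R}^m\to\mathbb{R}$ is the surrogate reward as a function of the estimate (it arises as $R_{\boldsymbol\theta}(\hat{\boldsymbol\theta})=F(z(\hat{\boldsymbol\theta}),\boldsymbol\theta)$, with $F(z,\boldsymbol\theta)$ the reward of decision $z$ and $z(\boldsymbol\theta)=\arg\max_zF(z,\boldsymbol\theta)$). Notation: $\mathbb{I}$ is the $m\times m$ identity matrix; $\mathbf{1}_m$ is the all-ones vector in $\mathbb{R}^m$; $\odot$ is the element-wise (Hadamard) product; $x^{\otimes k}$ is the $k$-fold outer product of $x\in\mathbb{R}^m$, with entries $x_{i_1}\cdots x_{i_k}$; $\otimes$ is the outer (tensor) product; $\langle\cdot,\cdot\rangle$ is the entrywise inner product of matrices or tensors of the same shape; $\|x\|_\infty=\max_i|x_i|$; $\|T\|_{\max}=\max_{i_1,i_2,\dots}|T_{i_1i_2\dots}|$ for a tensor $T$. $H_{\boldsymbol\theta}=\nabla^2_\phi R_{\boldsymbol\theta}(\phi)|_{\phi=\boldsymbol\theta}$ is the Hessian of the surrogate reward at the true parameter, and $\nabla^kR_{\boldsymbol\theta}(\cdot)$ is the $k$-th derivative tensor of $R_{\boldsymbol\theta}$ with respect to its argument. *)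

theory Defs
  imports "HOL-Probability.Probability" "HOL-Library.Landau_Symbols"
begin

(* A tensor of order k over R^m is represented by its entries T [i1, ..., ik]; only index
   lists of length k are relevant. *)
type_synonym 'm tensor = "'m list \<Rightarrow> real"

definition tensor_max :: "nat \<Rightarrow> 'm::finite tensor \<Rightarrow> real" where
  "tensor_max k T = Max ((\<lambda>is. \<bar>T is\<bar>) ` {is. length is = k})"

definition tensor_inner :: "nat \<Rightarrow> 'm::finite tensor \<Rightarrow> 'm tensor \<Rightarrow> real" where
  "tensor_inner k S T = (\<Sum>is | length is = k. S is * T is)"

(* The k-fold outer product of x, for every order k at once. *)
definition tensor_power :: "real ^ 'm \<Rightarrow> 'm tensor" where
  "tensor_power x is = prod_list (map (\<lambda>i. x $ i) is)"

definition outer :: "real ^ 'm \<Rightarrow> real ^ 'm \<Rightarrow> real ^ 'm ^ 'm" where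
  "outer x y = (\<chi> i j. x $ i * y $ j)"

(* Tensor product of a vector and a matrix, a tensor of order 3. *)
definition vec_mat_outer :: "real ^ 'm \<Rightarrow> real ^ 'm ^ 'm \<Rightarrow> 'm tensor" where
  "vec_mat_outer v S is = v $ (is ! 0) * S $ (is ! 1) $ (is ! 2)"

definition diag :: "real ^ 'm \<Rightarrow> real ^ 'm ^ 'm" where
  "diag v = (\<chi> i j. if i = j then v $ i else 0)"

(* deriv_tensor f x [i1, ..., ik] is the iterated partial derivative d_i1 ... d_ik f at x, the
   (i1, ..., ik) entry of the k-th derivative tensor of f at x.  It is meaningful where f is k
   times differentiable in the sense below. *)
primrec deriv_tensor :: "(real ^ 'm \<Rightarrow> real) \<Rightarrow> real ^ 'm \<Rightarrow> 'm::finite tensor" where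
  "deriv_tensor f x [] = f x"
| "deriv_tensor f x (i # is) = frechet_derivative (\<lambda>y. deriv_tensor f y is) (at x) (axis i 1)"

(* k-fold Frechet differentiability on all of R^m: a map into a finite-dimensional space is
   differentiable iff its components are, so it suffices to ask this of the entries of the
   derivative tensors of order < k. *)
definition times_differentiable :: "nat \<Rightarrow> (real ^ 'm::finite \<Rightarrow> real) \<Rightarrow> bool" where
  "times_differentiable k f \<longleftrightarrow>
     (\<forall>is. length is < k \<longrightarrow> (\<forall>x. (\<lambda>y. deriv_tensor f y is) differentiable (at x)))"

definition hessian :: "(real ^ 'm \<Rightarrow> real) \<Rightarrow> real ^ 'm \<Rightarrow> real ^ 'm ^ 'm::finite" where
  "hessian f x = (\<chi> i j. deriv_tensor f x [i, j])"

(* Stated through the quadratic form alone; symmetry is not required of A. *)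
definition negative_definite :: "real ^ 'm ^ 'm \<Rightarrow> bool" where
  "negative_definite A \<longleftrightarrow> (\<forall>x. x \<noteq> 0 \<longrightarrow> x \<bullet> (A *v x) < 0)"

definition quad_coeff :: "(real ^ 'm \<Rightarrow> real) \<Rightarrow> real ^ 'm \<Rightarrow> real ^ 'm ^ 'm" where
  "quad_coeff R \<theta> = (\<chi> i j. hessian R \<theta> $ i $ j * \<theta> $ i * \<theta> $ j)"

(* On the vector types of HOL-Analysis, the multiplication * is entrywise (for matrices: the
   Hadamard product) and 1 is the all-ones vector. *)
definition lin_coeff ::
  "(real ^ 'm \<Rightarrow> real) \<Rightarrow> real ^ 'm \<Rightarrow> real ^ 'm ^ 'm \<Rightarrow> real ^ 'm ^ 'm \<Rightarrow> real ^ 'm" where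
  "lin_coeff R \<theta> \<Sigma> M = (hessian R \<theta> * (2 *\<^sub>R \<Sigma> + M)) *v 1"

definition adjusted :: "(nat \<Rightarrow> 'a \<Rightarrow> real ^ 'm) \<Rightarrow> real ^ 'm \<Rightarrow> nat \<Rightarrow> 'a \<Rightarrow> real ^ 'm" where
  "adjusted est l n \<omega> = (mat 1 + (1 / real n) *\<^sub>R diag l) *v est n \<omega>"

definition scaled_improvement ::
  "(nat \<Rightarrow> 'a measure) \<Rightarrow> (nat \<Rightarrow> 'a \<Rightarrow> real ^ 'm) \<Rightarrow> (real ^ 'm \<Rightarrow> real) \<Rightarrow> real ^ 'm \<Rightarrow> nat \<Rightarrow> real"
where
  "scaled_improvement P est R l n =
     (real n)\<^sup>2 * ((\<integral>\<omega>. R (adjusted est l n \<omega>) \<partial>P n) - (\<integral>\<omega>. R (est n \<omega>) \<partial>P n))"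

definition asymptotic_improvement ::
  "(nat \<Rightarrow> 'a measure) \<Rightarrow> (nat \<Rightarrow> 'a \<Rightarrow> real ^ 'm) \<Rightarrow> (real ^ 'm \<Rightarrow> real) \<Rightarrow> real ^ 'm \<Rightarrow> real"
where
  "asymptotic_improvement P est R l = lim (scaled_improvement P est R l)"

end

theory Submission
  imports Defs
begin

text \<open>
  Write \<open>\<delta>\<close> for the estimation error \<open>est - \<theta>\<close>. The adjusted estimator has the error \<open>\<delta>'\<close> with entries
  \<open>(1 + l\<^sub>i / n) \<delta>\<^sub>i + l\<^sub>i \<theta>\<^sub>i / n\<close>. Expand the reward at \<open>\<theta>\<close> to fourth order for both errors; the
  remainders are bounded by a multiple of \<open>\<parallel>\<delta>\<parallel>\<^sup>5\<close> and \<open>\<parallel>\<delta>'\<parallel>\<^sup>5\<close>, whose expectations are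
  \<open>O(n\<^sup>-\<^sup>5\<^sup>/\<^sup>2) = o(n\<^sup>-\<^sup>2)\<close>. After scaling by \<open>n\<^sup>2\<close>, the differences between the moments of \<open>\<delta>'\<close> and those
  of \<open>\<delta>\<close> converge: those of order 2 give \<open>A\<close> and the part of \<open>b\<close> with \<open>\<Sigma>\<close>, those of order 3 give by
  symmetry of the third derivative its contraction with \<open>(\<Lambda>\<theta>) \<otimes> \<Sigma>\<close>, which the hypothesis on \<open>M\<close> turns
  into the rest of \<open>b\<close>, and those of order 4 vanish.
\<close>

subsection \<open>Taylor expansion with derivative tensors\<close>

text \<open>The head of an index list is the outermost derivative in \<open>deriv_tensor\<close>, so
  peeling it off matches sums over entries with that recursion.\<close>

lemma sum_lists_length_Suc:
  fixes f :: "'m::finite list \<Rightarrow> 'b::comm_monoid_add"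
  shows "(\<Sum>is | length is = Suc k. f is) = (\<Sum>i\<in>UNIV. \<Sum>is | length is = k. f (i # is))"
proof -
  have "(\<Sum>is | length is = Suc k. f is) = (\<Sum>(i, is)\<in>UNIV \<times> {is. length is = k}. f (i # is))"
    by (rule sum.reindex_bij_witness[where i = "\<lambda>(i, is). i # is" and j = "\<lambda>is. (hd is, tl is)"])
      (auto simp: length_Suc_conv)
  then show ?thesis
    by (simp add: sum.cartesian_product)
qed

lemma finite_lists_of_length: "finite {is :: 'm::finite list. length is = k}"
  using finite_lists_length_eq[of "UNIV :: 'm set" k] by simp

section \<open>Maximum norm of tensor powers\<close>

lemma abs_tensor_power_le:
  fixes x :: "real ^ 'm::finite"
  shows "\<bar>tensor_power x is\<bar> \<le> infnorm x ^ length is"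
  unfolding tensor_power_def
  by (induction "is") (auto simp: abs_mult infnorm_pos_le intro!: mult_mono component_le_infnorm_cart)

lemma infnorm_attained:
  fixes x :: "real ^ 'm::finite"
  obtains i where "infnorm x = \<bar>x $ i\<bar>"
proof -
  have fin: "finite (range (\<lambda>i. \<bar>x $ i\<bar>))"
    by simp
  have "infnorm x = Max (range (\<lambda>i. \<bar>x $ i\<bar>))"
    unfolding infnorm_cart by (subst cSup_eq_Max[symmetric]) (auto simp: full_SetCompr_eq)
  moreover have "Max (range (\<lambda>i. \<bar>x $ i\<bar>)) \<in> range (\<lambda>i. \<bar>x $ i\<bar>)"
    using Max_in[OF fin] by simp
  ultimately have "infnorm x \<in> range (\<lambda>i. \<bar>x $ i\<bar>)"
    by (rule ssubst)
  then show ?thesis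
    using that by blast
qed

text \<open>Every entry is a product of \<open>k\<close> coordinates, and repeating a coordinate of
  largest modulus attains the bound. This turns the moment conditions on tensor powers into
  conditions on powers of \<open>infnorm\<close>.\<close>

lemma tensor_max_tensor_power:
  fixes x :: "real ^ 'm::finite"
  shows "tensor_max k (tensor_power x) = infnorm x ^ k"
  unfolding tensor_max_def
proof (rule Max_eqI)
  show "finite ((\<lambda>is. \<bar>tensor_power x is\<bar>) ` {is. length is = k})"
    by (simp add: finite_lists_of_length)
  show "y \<le> infnorm x ^ k" if "y \<in> (\<lambda>is. \<bar>tensor_power x is\<bar>) ` {is. length is = k}" for y
    using that abs_tensor_power_le[of x] by auto
  obtain i where i: "infnorm x = \<bar>x $ i\<bar>"
    by (rule infnorm_attained)
  have "infnorm x ^ k = \<bar>tensor_power x (replicate k i)\<bar>"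
    unfolding tensor_power_def i by (simp add: power_abs)
  then show "infnorm x ^ k \<in> (\<lambda>is. \<bar>tensor_power x is\<bar>) ` {is. length is = k}"
    by auto
qed

text \<open>The chain rule: one derivative in \<open>t\<close> adds one index at the head,
  contracted with \<open>v\<close>.\<close>

lemma deriv_tensor_along_line:
  fixes f :: "real ^ 'm::finite \<Rightarrow> real"
  assumes "times_differentiable n f" and "length is < n"
  shows "((\<lambda>t. deriv_tensor f (x + t *\<^sub>R v) is) has_real_derivative
    (\<Sum>i\<in>UNIV. v $ i * deriv_tensor f (x + t *\<^sub>R v) (i # is))) (at t)"
proof -
  let ?g = "\<lambda>y. deriv_tensor f y is"
  let ?D = "frechet_derivative ?g (at (x + t *\<^sub>R v))"
  have D: "(?g has_derivative ?D) (at (x + t *\<^sub>R v))"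
    using assms by (simp add: times_differentiable_def frechet_derivative_works)
  then have lin: "linear ?D"
    by (rule has_derivative_linear)
  have "((\<lambda>t. x + t *\<^sub>R v) has_derivative (\<lambda>s. s *\<^sub>R v)) (at t)"
    by (auto intro!: derivative_eq_intros)
  from has_derivative_compose[OF this D]
  have "((\<lambda>t. ?g (x + t *\<^sub>R v)) has_derivative (\<lambda>s. ?D (s *\<^sub>R v))) (at t)" .
  moreover have "?D (s *\<^sub>R v) = (\<Sum>i\<in>UNIV. v $ i * deriv_tensor f (x + t *\<^sub>R v) (i # is)) * s" for s
  proof -
    \<comment> \<open>Expanding \<open>v\<close> in the standard basis leaves only values of the
      derivative at \<open>axis i 1\<close>, which are entries of
      \<open>deriv_tensor\<close>.\<close>
    have v: "v = (\<Sum>i\<in>UNIV. (v $ i) *\<^sub>R axis i 1)"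
      using basis_expansion[of v] by (simp add: scalar_mult_eq_scaleR)
    have "?D (s *\<^sub>R v) = s * ?D v"
      using linear_scale[OF lin] by simp
    also have "?D v = ?D (\<Sum>i\<in>UNIV. (v $ i) *\<^sub>R axis i 1)"
      using v by simp
    also have "\<dots> = (\<Sum>i\<in>UNIV. v $ i * ?D (axis i 1))"
      by (simp add: linear_sum[OF lin] linear_scale[OF lin])
    finally show ?thesis
      by simp
  qed
  ultimately show ?thesis
    by (simp add: has_field_derivative_def)
qed

text \<open>Maclaurin's theorem with Lagrange remainder for \<open>f (x + t *\<^sub>R v)\<close> as
  a function of \<open>t\<close>, evaluated at 1. The location of \<open>t\<close> in the unit
  interval is dropped, because the fifth derivative is later bounded globally.\<close>

lemma Taylor_deriv_tensor:
  fixes f :: "real ^ 'm::finite \<Rightarrow> real"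
  assumes f: "times_differentiable n f" and "n > 0"
  shows "\<exists>t. f (x + v) =
    (\<Sum>k<n. tensor_inner k (deriv_tensor f x) (tensor_power v) / fact k) +
    tensor_inner n (deriv_tensor f (x + t *\<^sub>R v)) (tensor_power v) / fact n"
proof -
  define d where "d = (\<lambda>k t. tensor_inner k (deriv_tensor f (x + t *\<^sub>R v)) (tensor_power v))"
  have "DERIV (d k) t :> d (Suc k) t" if "k < n" for k t
  proof -
    have "DERIV (d k) t :> (\<Sum>is | length is = k.
        (\<Sum>i\<in>UNIV. v $ i * deriv_tensor f (x + t *\<^sub>R v) (i # is)) * tensor_power v is)"
      unfolding d_def tensor_inner_def using that
      by (intro DERIV_sum DERIV_cmult_right deriv_tensor_along_line[OF f]) auto
    also have "(\<Sum>is | length is = k.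
        (\<Sum>i\<in>UNIV. v $ i * deriv_tensor f (x + t *\<^sub>R v) (i # is)) * tensor_power v is) = d (Suc k) t"
      unfolding d_def tensor_inner_def sum_lists_length_Suc sum_distrib_right
      by (subst sum.swap) (simp add: tensor_power_def mult_ac)
    finally show ?thesis .
  qed
  then have "\<exists>t. 0 < t \<and> t < 1 \<and> d 0 1 = (\<Sum>k<n. d k 0 / fact k * 1 ^ k) + d n t / fact n * 1 ^ n"
    using \<open>n > 0\<close> by (intro Maclaurin) auto
  then show ?thesis
    unfolding d_def by (auto simp: tensor_inner_def tensor_power_def)
qed

lemma Taylor_deriv_tensor_bound:
  fixes f :: "real ^ 'm::finite \<Rightarrow> real"
  assumes f: "times_differentiable n f" and "n > 0"
    and B: "\<And>\<phi>. tensor_max n (deriv_tensor f \<phi>) \<le> B"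
  shows "\<exists>C\<ge>0. \<forall>v. \<bar>f (x + v) -
    (\<Sum>k<n. tensor_inner k (deriv_tensor f x) (tensor_power v) / fact k)\<bar> \<le> C * infnorm v ^ n"
proof (intro exI conjI allI)
  let ?I = "{is :: 'm list. length is = n}"
  have entry: "\<bar>deriv_tensor f \<phi> is\<bar> \<le> B" if "length is = n" for "is" \<phi>
  proof -
    have "\<bar>deriv_tensor f \<phi> is\<bar> \<le> tensor_max n (deriv_tensor f \<phi>)"
      unfolding tensor_max_def using that by (intro Max_ge) (auto simp: finite_lists_of_length)
    with B[of \<phi>] show ?thesis
      by linarith
  qed
  \<comment> \<open>Some index list of length \<open>n\<close> exists, and the modulus of its entry
    lies below \<open>B\<close>.\<close>
  have "B \<ge> 0"
    using entry[of "replicate n undefined" 0] by (auto intro: order_trans[OF abs_ge_zero])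
  then show "card ?I * B / fact n \<ge> 0"
    by simp
  fix v
  have bound: "\<bar>tensor_inner n (deriv_tensor f \<phi>) (tensor_power v)\<bar> \<le> card ?I * B * infnorm v ^ n" for \<phi>
  proof -
    have "\<bar>tensor_inner n (deriv_tensor f \<phi>) (tensor_power v)\<bar>
        \<le> (\<Sum>is\<in>?I. \<bar>deriv_tensor f \<phi> is * tensor_power v is\<bar>)"
      unfolding tensor_inner_def by (rule sum_abs)
    also have "\<dots> \<le> (\<Sum>is\<in>?I. B * infnorm v ^ n)"
      using entry abs_tensor_power_le[of v] \<open>B \<ge> 0\<close>
      by (intro sum_mono) (auto simp: abs_mult intro!: mult_mono)
    finally show ?thesis
      by simp
  qed
  obtain t where "f (x + v) -
      (\<Sum>k<n. tensor_inner k (deriv_tensor f x) (tensor_power v) / fact k) =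
      tensor_inner n (deriv_tensor f (x + t *\<^sub>R v)) (tensor_power v) / fact n"
    using Taylor_deriv_tensor[OF f \<open>n > 0\<close>, of x v] by auto
  with bound[of "x + t *\<^sub>R v"] show "\<bar>f (x + v) -
      (\<Sum>k<n. tensor_inner k (deriv_tensor f x) (tensor_power v) / fact k)\<bar>
      \<le> card ?I * B / fact n * infnorm v ^ n"
    by (simp add: divide_right_mono)
qed

section \<open>Symmetry of higher derivatives\<close>

text \<open>The difference quotient is symmetric in \<open>u\<close> and \<open>v\<close>, hence so is its limit.\<close>

lemma second_difference_quotient_tendsto:
  fixes f :: "'a::real_normed_vector \<Rightarrow> real"
  assumes f: "\<And>y. (f has_derivative f' y) (at y)"
    and D: "((\<lambda>y. f' y u) has_derivative D) (at x)"
  shows "((\<lambda>s. (f (x + s *\<^sub>R u + s *\<^sub>R v) - f (x + s *\<^sub>R u) - f (x + s *\<^sub>R v) + f x) / s\<^sup>2)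
    \<longlongrightarrow> D v) (at_right 0)"
proof (rule tendstoI)
  fix e :: real assume "e > 0"
  \<comment> \<open>Both points used below lie within \<open>s * c\<close> of \<open>x\<close>, and
    their distances from \<open>x\<close> add up to at most that. The factor 2 in \<open>e'\<close>
    leaves a final error of \<open>e / 2\<close>.\<close>
  define c where "c = 2 * norm u + norm v + 1"
  have "c > 0"
    unfolding c_def by (simp add: add_nonneg_pos)
  define e' where "e' = e / (2 * c)"
  have "e' > 0"
    using \<open>e > 0\<close> \<open>c > 0\<close> by (simp add: e'_def)
  then obtain d where "d > 0" and d: "\<And>y. norm (y - x) < d \<Longrightarrow>
      \<bar>f' y u - f' x u - D (y - x)\<bar> \<le> e' * norm (y - x)"
    using D by (auto simp: has_derivative_at_alt)
  have lin: "linear D"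
    using D by (rule has_derivative_linear)
  have "eventually (\<lambda>s. s > 0 \<and> s < d / c) (at_right (0::real))"
    using \<open>d > 0\<close> \<open>c > 0\<close> by (auto intro!: eventually_conj eventually_at_right_less
      order_tendstoD(2)[OF tendsto_ident_at])
  then show "eventually (\<lambda>s. dist ((f (x + s *\<^sub>R u + s *\<^sub>R v) - f (x + s *\<^sub>R u) - f (x + s *\<^sub>R v) + f x) / s\<^sup>2)
      (D v) < e) (at_right 0)"
  proof eventually_elim
    case (elim s)
    then have "s > 0" and sc: "s * c < d"
      using \<open>c > 0\<close> by (auto simp: field_simps)
    \<comment> \<open>The numerator of the quotient is \<open>\<phi> s - \<phi> 0\<close>. The mean
      value theorem reduces it to derivatives in direction \<open>u\<close>, whose own
      differentiability is known at \<open>x\<close> only.\<close>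
    define \<phi> where "\<phi> t = f (x + t *\<^sub>R u + s *\<^sub>R v) - f (x + t *\<^sub>R u)" for t
    have "DERIV \<phi> t :> f' (x + t *\<^sub>R u + s *\<^sub>R v) u - f' (x + t *\<^sub>R u) u" for t
    proof -
      have line: "((\<lambda>t. f (z + t *\<^sub>R u)) has_real_derivative f' (z + t *\<^sub>R u) u) (at t)" for z t
      proof -
        have "((\<lambda>t. z + t *\<^sub>R u) has_derivative (\<lambda>r. r *\<^sub>R u)) (at t)"
          by (auto intro!: derivative_eq_intros)
        from has_derivative_compose[OF this f]
        have "((\<lambda>t. f (z + t *\<^sub>R u)) has_derivative (\<lambda>r. f' (z + t *\<^sub>R u) (r *\<^sub>R u))) (at t)" .
        moreover have "(\<lambda>r. f' (z + t *\<^sub>R u) (r *\<^sub>R u)) = (*) (f' (z + t *\<^sub>R u) u)"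
          using linear_scale[OF has_derivative_linear[OF f]] by (auto simp: mult.commute)
        ultimately show ?thesis
          by (simp add: has_field_derivative_def)
      qed
      have "DERIV (\<lambda>t. f ((x + s *\<^sub>R v) + t *\<^sub>R u) - f (x + t *\<^sub>R u)) t :>
          f' ((x + s *\<^sub>R v) + t *\<^sub>R u) u - f' (x + t *\<^sub>R u) u"
        by (intro DERIV_diff line)
      then show ?thesis
        unfolding \<phi>_def by (simp add: add_ac)
    qed
    from MVT2[OF \<open>s > 0\<close> this] obtain \<xi> where \<xi>: "0 < \<xi>" "\<xi> < s"
      and mvt: "\<phi> s - \<phi> 0 = s * (f' (x + \<xi> *\<^sub>R u + s *\<^sub>R v) u - f' (x + \<xi> *\<^sub>R u) u)"
      by auto
    define w1 where "w1 = \<xi> *\<^sub>R u + s *\<^sub>R v"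
    define w2 where "w2 = \<xi> *\<^sub>R u"
    have n2: "norm w2 \<le> s * norm u"
      using \<xi> by (simp add: w2_def mult_right_mono)
    have n1: "norm w1 \<le> s * norm u + s * norm v"
      using n2 norm_triangle_ineq[of w2 "s *\<^sub>R v"] \<open>s > 0\<close> by (simp add: w1_def w2_def)
    have sc': "s * c = 2 * (s * norm u) + s * norm v + s"
      by (simp add: c_def algebra_simps)
    have "0 \<le> s * norm u" "0 \<le> s * norm v"
      using \<open>s > 0\<close> by auto
    then have small: "norm w1 < d" "norm w2 < d"
      using n1 n2 sc sc' \<open>s > 0\<close> by linarith+
    \<comment> \<open>Both derivatives are linearised at \<open>x\<close>, so that
      \<open>f' x u\<close> cancels in their difference.\<close>
    have "\<bar>f' (x + w1) u - f' x u - D w1\<bar> \<le> e' * norm w1" "\<bar>f' (x + w2) u - f' x u - D w2\<bar> \<le> e' * norm w2"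
      using d[of "x + w1"] d[of "x + w2"] small by auto
    moreover have "D w1 - D w2 = s * D v"
      by (simp add: w1_def w2_def linear_add[OF lin] linear_scale[OF lin])
    moreover have "norm w1 + norm w2 \<le> s * c"
      using n1 n2 sc' \<open>s > 0\<close> by linarith
    then have "e' * norm w1 + e' * norm w2 \<le> e' * (s * c)"
      using \<open>e' > 0\<close> by (simp flip: distrib_left)
    ultimately have *: "\<bar>f' (x + w1) u - f' (x + w2) u - s * D v\<bar> \<le> e' * (s * c)"
      by linarith
    have "\<phi> s - \<phi> 0 - s\<^sup>2 * D v = s * (f' (x + w1) u - f' (x + w2) u - s * D v)"
      unfolding mvt by (simp add: w1_def w2_def algebra_simps power2_eq_square)
    then have "\<bar>\<phi> s - \<phi> 0 - s\<^sup>2 * D v\<bar> \<le> s * (e' * (s * c))"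
      using * \<open>s > 0\<close> by (simp add: abs_mult)
    also have "\<dots> = s\<^sup>2 * (e / 2)"
      using \<open>c > 0\<close> by (simp add: e'_def power2_eq_square)
    finally have le: "\<bar>\<phi> s - \<phi> 0 - s\<^sup>2 * D v\<bar> \<le> s\<^sup>2 * (e / 2)" .
    have "dist ((\<phi> s - \<phi> 0) / s\<^sup>2) (D v) = \<bar>\<phi> s - \<phi> 0 - s\<^sup>2 * D v\<bar> / s\<^sup>2"
      using \<open>s > 0\<close> by (simp add: dist_real_def field_simps)
    also have "\<dots> \<le> e / 2"
      using le \<open>s > 0\<close> by (simp add: field_simps)
    finally show ?case
      using \<open>e > 0\<close> by (simp add: \<phi>_def algebra_simps)
  qed
qed

text \<open>The form of Schwarz's theorem that fits \<open>times_differentiable\<close>, which does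
  not ask for continuity of the derivatives of top order.\<close>

lemma second_derivative_symmetric:
  fixes f :: "'a::real_normed_vector \<Rightarrow> real"
  assumes f: "\<And>y. (f has_derivative f' y) (at y)"
    and "((\<lambda>y. f' y u) has_derivative Du) (at x)"
    and "((\<lambda>y. f' y v) has_derivative Dv) (at x)"
  shows "Du v = Dv u"
proof -
  have "((\<lambda>s. (f (x + s *\<^sub>R u + s *\<^sub>R v) - f (x + s *\<^sub>R u) - f (x + s *\<^sub>R v) + f x) / s\<^sup>2)
      \<longlongrightarrow> Du v) (at_right 0)"
    by (rule second_difference_quotient_tendsto) fact+
  moreover have "((\<lambda>s. (f (x + s *\<^sub>R v + s *\<^sub>R u) - f (x + s *\<^sub>R v) - f (x + s *\<^sub>R u) + f x) / s\<^sup>2)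
      \<longlongrightarrow> Dv u) (at_right 0)"
    by (rule second_difference_quotient_tendsto) fact+
  ultimately show ?thesis
    by (intro tendsto_unique[OF trivial_limit_at_right_real]) (simp_all add: algebra_simps)
qed

text \<open>Symmetry is applied to the entry with indices \<open>is\<close> as a function of the
  point; the bound leaves room for two more derivatives. Exchanges deeper in the list follow by
  differentiating this identity.\<close>

lemma deriv_tensor_swap:
  fixes f :: "real ^ 'm::finite \<Rightarrow> real"
  assumes "times_differentiable n f" and "Suc (length is) < n"
  shows "deriv_tensor f x (i # j # is) = deriv_tensor f x (j # i # is)"
proof -
  have D: "((\<lambda>y. deriv_tensor f y js) has_derivative frechet_derivative (\<lambda>y. deriv_tensor f y js) (at y)) (at y)"
    if "length js < n" for js y
    using assms that by (simp add: times_differentiable_def frechet_derivative_works)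
  show ?thesis
    using second_derivative_symmetric[where f = "\<lambda>y. deriv_tensor f y is" and
        f' = "\<lambda>y. frechet_derivative (\<lambda>y. deriv_tensor f y is) (at y)" and u = "axis i 1" and v = "axis j 1",
        OF D D[of "i # is", simplified] D[of "j # is", simplified]] assms(2)
    by simp
qed

section \<open>Integrability, decay rates and quadratic maximization\<close>

lemma tensor_power_Nil [simp]: "tensor_power x [] = 1"
  and tensor_power_Cons [simp]: "tensor_power x (i # is) = x $ i * tensor_power x is"
  and tensor_power_append [simp]: "tensor_power x (is @ js) = tensor_power x is * tensor_power x js"
  by (simp_all add: tensor_power_def)

text \<open>Needed before coordinates may be taken inside the integral of a vector-valued error. The
  function is the sum of its coordinates embedded by \<open>axis i\<close>.\<close>

lemma integrable_vec_lambda: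
  fixes f :: "'a \<Rightarrow> 'b::euclidean_space ^ 'n"
  assumes "\<And>i. integrable M (\<lambda>\<omega>. f \<omega> $ i)"
  shows "integrable M f"
proof -
  have "linear (axis i :: 'b \<Rightarrow> 'b ^ 'n)" for i
    by (rule linearI) (auto simp: vec_eq_iff axis_def)
  then have "integrable M (\<lambda>\<omega>. \<Sum>i\<in>UNIV. axis i (f \<omega> $ i))"
    using assms by (intro Bochner_Integration.integrable_sum integrable_bounded_linear[of "axis i" for i])
      (auto simp: linear_conv_bounded_linear)
  moreover have "(\<Sum>i\<in>UNIV. axis i (f \<omega> $ i)) = f \<omega>" for \<omega>
    by (simp add: vec_eq_iff axis_def if_distrib cong: if_cong)
  ultimately show ?thesis
    by simp
qed

lemma continuous_on_tensor_power:
  "continuous_on A (\<lambda>x :: real ^ 'm::finite. tensor_power x is)"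
  by (induction "is") (auto intro!: continuous_intros)

text \<open>On a finite measure space all powers up to order \<open>d\<close> are dominated by one
  plus the power of order \<open>d\<close>.\<close>

lemma integrable_tensor_power:
  fixes X :: "'a \<Rightarrow> real ^ 'm::finite"
  assumes "finite_measure M" and X: "X \<in> borel_measurable M"
    and int: "integrable M (\<lambda>\<omega>. infnorm (X \<omega>) ^ d)" and "length is \<le> d"
  shows "integrable M (\<lambda>\<omega>. tensor_power (X \<omega>) is)"
proof (rule Bochner_Integration.integrable_bound)
  interpret finite_measure M by fact
  show "integrable M (\<lambda>\<omega>. 1 + infnorm (X \<omega>) ^ d)"
    using int by simp
  show "(\<lambda>\<omega>. tensor_power (X \<omega>) is) \<in> borel_measurable M"
    using X by (rule borel_measurable_continuous_on[OF continuous_on_tensor_power])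
  show "AE \<omega> in M. norm (tensor_power (X \<omega>) is) \<le> norm (1 + infnorm (X \<omega>) ^ d)"
  proof (rule AE_I2)
    fix \<omega>
    have "infnorm (X \<omega>) ^ length is \<le> 1 + infnorm (X \<omega>) ^ d"
    proof (cases "infnorm (X \<omega>) \<le> 1")
      case True
      then show ?thesis
        using infnorm_pos_le[of "X \<omega>"] by (auto intro: order_trans[OF power_le_one] simp: zero_le_power)
    next
      case False
      then have "infnorm (X \<omega>) ^ length is \<le> infnorm (X \<omega>) ^ d"
        using \<open>length is \<le> d\<close> by (intro power_increasing) auto
      then show ?thesis
        by simp
    qed
    then show "norm (tensor_power (X \<omega>) is) \<le> norm (1 + infnorm (X \<omega>) ^ d)"
      using abs_tensor_power_le[of "X \<omega>" "is"] infnorm_pos_le[of "X \<omega>"] by (simp add: abs_of_nonneg)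
  qed
qed

text \<open>Used with \<open>p = 1\<close> for the moments of order at least 3, and with
  \<open>p = 2\<close> for the fifth moment that controls the Taylor remainders.\<close>

lemma tendsto_zero_of_bigo_powr:
  assumes f: "f \<in> O(\<lambda>n. real n powr (- b))" and "real p < b"
  shows "(\<lambda>n. real n ^ p * f n) \<longlonglongrightarrow> 0"
proof -
  from f obtain c where "\<forall>\<^sub>F n in sequentially. norm (f n) \<le> c * norm (real n powr (- b))"
    by (auto elim: landau_o.bigE)
  then have "\<forall>\<^sub>F n in sequentially. norm (real n ^ p * f n) \<le> real n powr (real p - b) * c"
    using eventually_gt_at_top[of 0]
  proof eventually_elim
    case (elim n)
    then have "real n ^ p * norm (f n) \<le> real n ^ p * (c * real n powr (- b))"
      by (intro mult_left_mono) auto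
    also have "\<dots> = real n powr (real p - b) * c"
      using elim by (simp add: powr_diff powr_minus powr_realpow field_simps)
    finally show ?case
      by (simp add: abs_mult)
  qed
  moreover have "(\<lambda>n. real n powr (real p - b)) \<longlonglongrightarrow> 0"
    using \<open>real p < b\<close> by (intro tendsto_neg_powr filterlim_real_sequentially) simp
  then have "(\<lambda>n. real n powr (real p - b) * c) \<longlonglongrightarrow> 0"
    by (rule tendsto_mult_left_zero)
  ultimately show ?thesis
    by (rule Lim_null_comparison)
qed

text \<open>A trivial kernel gives invertibility. The maximizer comes from completing the square at
  \<open>z\<close>, where the gradient \<open>A *v z + (1 / 2) *\<^sub>R b\<close> of the quadratic
  vanishes.\<close>

lemma negative_definite_quadratic_arg_max:
  fixes A :: "real ^ 'm ^ 'm" and b :: "real ^ 'm"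
  assumes sym: "transpose A = A" and neg: "negative_definite A"
  shows "invertible A"
    and "is_arg_max (\<lambda>l. 1 / 2 * (l \<bullet> (A *v l) + b \<bullet> l)) (\<lambda>_. True) l \<longleftrightarrow>
      l = - (1 / 2) *\<^sub>R (matrix_inv A *v b)"
proof -
  have "x = 0" if "A *v x = 0" for x
    using neg that unfolding negative_definite_def by force
  then show inv: "invertible A"
    by (auto simp: invertible_left_inverse matrix_left_invertible_ker)
  define q where "q l = 1 / 2 * (l \<bullet> (A *v l) + b \<bullet> l)" for l
  define z where "z = - (1 / 2) *\<^sub>R (matrix_inv A *v b)"
  \<comment> \<open>\<open>matrix_inv\<close> is a choice, so its defining property is extracted
    from the existence of an inverse.\<close>
  have "A ** matrix_inv A = mat 1"
    using inv unfolding invertible_def matrix_inv_def by (rule someI2_ex) simp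
  then have "A *v (matrix_inv A *v b) = b"
    by (simp add: matrix_vector_mul_assoc)
  then have Az: "A *v z = - (1 / 2) *\<^sub>R b"
    unfolding z_def by (metis matrix_vector_mult_scaleR)
  \<comment> \<open>Symmetry merges the two cross terms, and \<open>Az\<close> then cancels them
    against the linear part.\<close>
  have self_adjoint: "x \<bullet> (A *v y) = y \<bullet> (A *v x)" for x y
    using sym by (metis dot_lmul_matrix inner_commute transpose_matrix_vector)
  have gap: "q l = q z + 1 / 2 * ((l - z) \<bullet> (A *v (l - z)))" for l
    using self_adjoint[of z l]
    by (simp add: q_def matrix_vector_mult_diff_distrib inner_diff_left inner_diff_right
        inner_add_right Az inner_commute field_simps)
  have "q l < q z" if "l \<noteq> z" for l
    using neg that unfolding negative_definite_def gap[of l] by simp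
  then have "is_arg_max q (\<lambda>_. True) l \<longleftrightarrow> l = z"
    unfolding is_arg_max_def by (metis order_less_asym)
  then show "is_arg_max (\<lambda>l. 1 / 2 * (l \<bullet> (A *v l) + b \<bullet> l)) (\<lambda>_. True) l \<longleftrightarrow>
      l = - (1 / 2) *\<^sub>R (matrix_inv A *v b)"
    by (simp add: q_def[abs_def] z_def)
qed

subsection \<open>Moments of the perturbed error\<close>

context
  fixes P :: "nat \<Rightarrow> 'a measure"
    and \<delta> :: "nat \<Rightarrow> 'a \<Rightarrow> real ^ 'm"
    and S :: "'m list \<Rightarrow> real"
    and l a :: "real ^ 'm"
begin

text \<open>This is the error of the adjusted estimator once \<open>a\<close> is the adjustment
  matrix applied to the true parameter. The moment computation treats \<open>a\<close> as
  arbitrary.\<close>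

definition perturbed :: "nat \<Rightarrow> 'a \<Rightarrow> real ^ 'm" where
  "perturbed n \<omega> = (\<chi> i. (1 + l $ i / n) * \<delta> n \<omega> $ i + a $ i / n)"

text \<open>
  Moments that mix both errors can be computed by recursion on the entries of the perturbed
  error: each step replaces one of them by an entry of the original error.
\<close>

definition mixed_moment :: "nat \<Rightarrow> 'm list \<Rightarrow> 'm list \<Rightarrow> real" where
  "mixed_moment n js is = (\<integral>\<omega>. tensor_power (\<delta> n \<omega>) js * tensor_power (perturbed n \<omega>) is \<partial>P n)"

text \<open>Expanding the leading perturbed entry moves it into \<open>js\<close> or replaces it by
  a constant, so the total degree never grows. Hence \<open>js\<close> is generalised in the
  induction.\<close>

lemma integrable_mixed_power:
  assumes "\<And>ks. length ks \<le> d \<Longrightarrow> integrable (P n) (\<lambda>\<omega>. tensor_power (\<delta> n \<omega>) ks)"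
    and "length js + length is \<le> d"
  shows "integrable (P n) (\<lambda>\<omega>. tensor_power (\<delta> n \<omega>) js * tensor_power (perturbed n \<omega>) is)"
  using assms(2)
proof (induction "is" arbitrary: js)
  case Nil
  then show ?case
    using assms(1) by simp
next
  case (Cons i "is")
  have "(\<lambda>\<omega>. tensor_power (\<delta> n \<omega>) js * tensor_power (perturbed n \<omega>) (i # is)) =
      (\<lambda>\<omega>. (1 + l $ i / n) * (tensor_power (\<delta> n \<omega>) (js @ [i]) * tensor_power (perturbed n \<omega>) is) +
        a $ i / n * (tensor_power (\<delta> n \<omega>) js * tensor_power (perturbed n \<omega>) is))"
    by (simp add: fun_eq_iff perturbed_def algebra_simps)
  moreover have "integrable (P n) (\<lambda>\<omega>. tensor_power (\<delta> n \<omega>) (js @ [i]) * tensor_power (perturbed n \<omega>) is)"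
    and "integrable (P n) (\<lambda>\<omega>. tensor_power (\<delta> n \<omega>) js * tensor_power (perturbed n \<omega>) is)"
    using Cons.prems by (auto intro!: Cons.IH simp del: tensor_power_append)
  ultimately show ?case
    by (simp only:) (intro Bochner_Integration.integrable_add integrable_mult_right)
qed

lemma mixed_moment_Cons:
  assumes "\<And>ks. length ks \<le> d \<Longrightarrow> integrable (P n) (\<lambda>\<omega>. tensor_power (\<delta> n \<omega>) ks)"
    and "length js + length is < d"
  shows "mixed_moment n js (i # is) = (1 + l $ i / n) * mixed_moment n (js @ [i]) is + a $ i / n * mixed_moment n js is"
proof -
  note int = integrable_mixed_power[where d = d, OF assms(1)]
  have "(\<lambda>\<omega>. tensor_power (\<delta> n \<omega>) js * tensor_power (perturbed n \<omega>) (i # is)) =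
      (\<lambda>\<omega>. (1 + l $ i / n) * (tensor_power (\<delta> n \<omega>) (js @ [i]) * tensor_power (perturbed n \<omega>) is) +
        a $ i / n * (tensor_power (\<delta> n \<omega>) js * tensor_power (perturbed n \<omega>) is))"
    by (simp add: fun_eq_iff perturbed_def algebra_simps)
  then have "mixed_moment n js (i # is) = (\<integral>\<omega>. (1 + l $ i / n) *
        (tensor_power (\<delta> n \<omega>) (js @ [i]) * tensor_power (perturbed n \<omega>) is) +
        a $ i / n * (tensor_power (\<delta> n \<omega>) js * tensor_power (perturbed n \<omega>) is) \<partial>P n)"
    unfolding mixed_moment_def by (rule arg_cong)
  also have "\<dots> = (1 + l $ i / n) * mixed_moment n (js @ [i]) is + a $ i / n * mixed_moment n js is"
    unfolding mixed_moment_def using int[of "js @ [i]" "is"] int[of js "is"] assms(2)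
    by (subst Bochner_Integration.integral_add) (auto simp del: tensor_power_append)
  finally show ?thesis .
qed

text \<open>\<open>S\<close> records the limits of the moments scaled by \<open>n\<close>. It is
  arbitrary here and becomes \<open>second_order \<Sigma>\<close> in the end.\<close>

context
  fixes d :: nat
  assumes prob: "\<And>n. n \<ge> 1 \<Longrightarrow> prob_space (P n)"
    and int: "\<forall>\<^sub>F n in sequentially. \<forall>ks. length ks \<le> d \<longrightarrow> integrable (P n) (\<lambda>\<omega>. tensor_power (\<delta> n \<omega>) ks)"
    and lim: "\<And>ks. ks \<noteq> [] \<Longrightarrow> length ks \<le> d \<Longrightarrow>
      (\<lambda>n. real n * (\<integral>\<omega>. tensor_power (\<delta> n \<omega>) ks \<partial>P n)) \<longlonglongrightarrow> S ks"
begin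

text \<open>The conjunct \<open>n \<ge> 1\<close> is carried along so that divisions by
  \<open>n\<close> can be cancelled where the recursion is used.\<close>

lemma eventually_mixed_moment_Cons:
  assumes "length js + length is < d"
  shows "\<forall>\<^sub>F n in sequentially. n \<ge> 1 \<and>
    mixed_moment n js (i # is) = (1 + l $ i / n) * mixed_moment n (js @ [i]) is + a $ i / n * mixed_moment n js is"
  using int eventually_ge_at_top[of 1]
  by eventually_elim (use mixed_moment_Cons assms in blast)

lemma coeff_tendsto: "(\<lambda>n. 1 + c / real n) \<longlonglongrightarrow> 1"
  using tendsto_add[OF tendsto_const lim_const_over_n[of c], of 1] by simp

text \<open>The empty moment is the total mass 1. A nonempty moment of the original error is
  \<open>1 / n\<close> times a convergent sequence, and the recursion carries its limit 0 over to
  perturbed entries.\<close>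

lemma mixed_moment_tendsto:
  assumes "length js + length is \<le> d"
  shows "(\<lambda>n. mixed_moment n js is) \<longlonglongrightarrow> (if js @ is = [] then 1 else 0)"
  using assms
proof (induction "is" arbitrary: js)
  case Nil
  show ?case
  proof (cases "js = []")
    case True
    have "\<forall>\<^sub>F n in sequentially. mixed_moment n [] [] = 1"
      using eventually_ge_at_top[of 1]
    proof eventually_elim
      case (elim n)
      then interpret prob_space "P n"
        by (rule prob)
      show ?case
        by (simp add: mixed_moment_def prob_space)
    qed
    then show ?thesis
      using True by (simp add: tendsto_eventually)
  next
    case False
    have "(\<lambda>n. 1 / real n * (real n * mixed_moment n js [])) \<longlonglongrightarrow> 0 * S js"
      using lim[OF False] Nil by (intro tendsto_mult lim_1_over_n) (simp add: mixed_moment_def)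
    moreover have "\<forall>\<^sub>F n in sequentially. 1 / real n * (real n * mixed_moment n js []) = mixed_moment n js []"
      using eventually_gt_at_top[of 0] by eventually_elim simp
    ultimately show ?thesis
      using False by (simp add: tendsto_cong)
  qed
next
  case (Cons i "is")
  have "(\<lambda>n. (1 + l $ i / n) * mixed_moment n (js @ [i]) is + a $ i / n * mixed_moment n js is) \<longlonglongrightarrow>
      1 * 0 + 0 * (if js @ is = [] then 1 else 0)"
    using Cons.IH[of "js @ [i]"] Cons.IH[of js] Cons.prems
    by (intro tendsto_add tendsto_mult coeff_tendsto lim_const_over_n) auto
  moreover have "\<forall>\<^sub>F n in sequentially.
      (1 + l $ i / n) * mixed_moment n (js @ [i]) is + a $ i / n * mixed_moment n js is = mixed_moment n js (i # is)"
    using eventually_mixed_moment_Cons[of js "is" i] Cons.prems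
    by (auto elim: eventually_mono)
  ultimately show ?case
    by (auto intro: Lim_transform_eventually)
qed

text \<open>With total order at least 2, the correction term of the recursion still contains an
  entry of an error and so vanishes in the limit. To this order perturbed and original entries are
  interchangeable.\<close>

lemma scaled_mixed_moment_tendsto:
  assumes "length js + length is \<le> d" and "2 \<le> length js + length is"
  shows "(\<lambda>n. n * mixed_moment n js is) \<longlonglongrightarrow> S (js @ is)"
  using assms
proof (induction "is" arbitrary: js)
  case Nil
  then have "js \<noteq> []"
    by auto
  with Nil show ?case
    using lim[of js] by (simp add: mixed_moment_def)
next
  case (Cons i "is")
  have "js @ is \<noteq> []"
    using Cons.prems by auto
  then have "(\<lambda>n. (1 + l $ i / n) * (n * mixed_moment n (js @ [i]) is) + a $ i * mixed_moment n js is) \<longlonglongrightarrow>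
      1 * S ((js @ [i]) @ is) + a $ i * 0"
    using Cons.IH[of "js @ [i]"] mixed_moment_tendsto[of js "is"] Cons.prems
    by (intro tendsto_add tendsto_mult coeff_tendsto tendsto_const) auto
  moreover have "\<forall>\<^sub>F n in sequentially.
      (1 + l $ i / n) * (n * mixed_moment n (js @ [i]) is) + a $ i * mixed_moment n js is = n * mixed_moment n js (i # is)"
    using eventually_mixed_moment_Cons[of js "is" i] Cons.prems
    by (auto elim!: eventually_mono simp: field_simps)
  ultimately show ?case
    by (auto intro: Lim_transform_eventually)
qed

text \<open>In order 1 the correction term multiplies the total mass, so the shift \<open>a\<close>
  survives as the bias of the perturbed error.\<close>

lemma scaled_first_moment_tendsto:
  assumes "d \<ge> 1" and "S [i] = 0"
  shows "(\<lambda>n. n * mixed_moment n [] [i]) \<longlonglongrightarrow> a $ i"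
proof -
  have "(\<lambda>n. (1 + l $ i / n) * (n * mixed_moment n [i] []) + a $ i * mixed_moment n [] []) \<longlonglongrightarrow> 1 * S [i] + a $ i * 1"
    using mixed_moment_tendsto[of "[]" "[]"] lim[of "[i]"] assms(1)
    by (intro tendsto_add tendsto_mult coeff_tendsto tendsto_const) (auto simp: mixed_moment_def)
  moreover have "\<forall>\<^sub>F n in sequentially.
      (1 + l $ i / n) * (n * mixed_moment n [i] []) + a $ i * mixed_moment n [] [] = n * mixed_moment n [] [i]"
    using eventually_mixed_moment_Cons[of "[]" "[]" i] assms(1)
    by (auto elim!: eventually_mono simp: field_simps)
  ultimately show ?thesis
    using assms(2) by (auto intro: Lim_transform_eventually)
qed

section \<open>Scaled differences of moments\<close>

definition moment_gap :: "nat \<Rightarrow> 'm list \<Rightarrow> 'm list \<Rightarrow> real" where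
  "moment_gap n js is = (real n)\<^sup>2 * (mixed_moment n js is - mixed_moment n (js @ is) [])"

lemma moment_gap_Nil [simp]: "moment_gap n js [] = 0"
  by (simp add: moment_gap_def)

text \<open>Perturbing one entry at a time makes the gap telescope: both gaps subtract the same
  unperturbed moment. Each change carries a factor \<open>1 / n\<close>, which leaves one factor
  \<open>n\<close> for the moments \<open>u\<close> and \<open>v\<close>.\<close>

lemma moment_gap_Cons_tendsto:
  assumes "length js + length is < d"
    and "(\<lambda>n. moment_gap n (js @ [i]) is) \<longlonglongrightarrow> x"
    and "(\<lambda>n. n * mixed_moment n (js @ [i]) is) \<longlonglongrightarrow> u"
    and "(\<lambda>n. n * mixed_moment n js is) \<longlonglongrightarrow> v"
  shows "(\<lambda>n. moment_gap n js (i # is)) \<longlonglongrightarrow> x + l $ i * u + a $ i * v"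
proof -
  have "(\<lambda>n. moment_gap n (js @ [i]) is + l $ i * (n * mixed_moment n (js @ [i]) is) + a $ i * (n * mixed_moment n js is))
      \<longlonglongrightarrow> x + l $ i * u + a $ i * v"
    using assms(2-4) by (intro tendsto_intros)
  moreover have "\<forall>\<^sub>F n in sequentially. moment_gap n (js @ [i]) is +
      l $ i * (n * mixed_moment n (js @ [i]) is) + a $ i * (n * mixed_moment n js is) = moment_gap n js (i # is)"
    using eventually_mixed_moment_Cons[OF assms(1), of i]
    by (auto elim!: eventually_mono simp: moment_gap_def field_simps power2_eq_square)
  ultimately show ?thesis
    by (rule Lim_transform_eventually)
qed

text \<open>Perturbing \<open>j\<close> first yields no shift term, because the original error has
  vanishing scaled bias. Perturbing \<open>i\<close> next meets the perturbed entry
  \<open>j\<close>, whose scaled bias is \<open>a $ j\<close>.\<close>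

lemma moment_gap_2_tendsto:
  assumes "d \<ge> 2" and "\<And>i. S [i] = 0"
  shows "(\<lambda>n. moment_gap n [] [i, j]) \<longlonglongrightarrow> (l $ i + l $ j) * S [i, j] + a $ i * a $ j"
proof -
  have "(\<lambda>n. moment_gap n [i] [j]) \<longlonglongrightarrow> 0 + l $ j * S [i, j] + a $ j * 0"
    using assms lim[of "[i]"] lim[of "[i, j]"]
    by - (rule moment_gap_Cons_tendsto, auto simp: mixed_moment_def)
  then have "(\<lambda>n. moment_gap n [] [i, j]) \<longlonglongrightarrow>
      (0 + l $ j * S [i, j] + a $ j * 0) + l $ i * S [i, j] + a $ i * a $ j"
    using assms scaled_mixed_moment_tendsto[of "[i]" "[j]"] scaled_first_moment_tendsto[of j]
    by - (rule moment_gap_Cons_tendsto, auto)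
  then show ?thesis
    by (simp add: algebra_simps)
qed

text \<open>The factors from \<open>l\<close> multiply scaled moments of order 3, which vanish in
  the limit. What remains is the shift of one entry times the second moment of the other
  two.\<close>

lemma moment_gap_3_tendsto:
  assumes "d \<ge> 3" and "\<And>i j k. S [i, j, k] = 0"
  shows "(\<lambda>n. moment_gap n [] [i, j, k]) \<longlonglongrightarrow>
    a $ i * S [j, k] + a $ j * S [i, k] + a $ k * S [i, j]"
proof -
  note lims = scaled_mixed_moment_tendsto
  have "(\<lambda>n. moment_gap n [i, j] [k]) \<longlonglongrightarrow> 0 + l $ k * 0 + a $ k * S [i, j]"
    using assms lims[of "[i, j]" "[]"] lims[of "[i, j, k]" "[]"]
    by - (rule moment_gap_Cons_tendsto, auto)
  then have "(\<lambda>n. moment_gap n [i] [j, k]) \<longlonglongrightarrow>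
      (0 + l $ k * 0 + a $ k * S [i, j]) + l $ j * 0 + a $ j * S [i, k]"
    using assms lims[of "[i]" "[k]"] lims[of "[i, j]" "[k]"]
    by - (rule moment_gap_Cons_tendsto, auto)
  then have "(\<lambda>n. moment_gap n [] [i, j, k]) \<longlonglongrightarrow>
      ((0 + l $ k * 0 + a $ k * S [i, j]) + l $ j * 0 + a $ j * S [i, k]) + l $ i * 0 + a $ i * S [j, k]"
    using assms lims[of "[]" "[j, k]"] lims[of "[i]" "[j, k]"]
    by - (rule moment_gap_Cons_tendsto, auto)
  then show ?thesis
    by (simp add: algebra_simps)
qed

text \<open>Each step contributes limits of order at least 3 only, all of them zero.\<close>

lemma moment_gap_high_tendsto:
  assumes S: "\<And>ks. length ks \<ge> 3 \<Longrightarrow> S ks = 0"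
    and "length js + length is \<le> d" and "4 \<le> length js + length is"
  shows "(\<lambda>n. moment_gap n js is) \<longlonglongrightarrow> 0"
  using assms(2,3)
proof (induction "is" arbitrary: js)
  case (Cons i "is")
  have "(\<lambda>n. moment_gap n js (i # is)) \<longlonglongrightarrow> 0 + l $ i * S ((js @ [i]) @ is) + a $ i * S (js @ is)"
    using Cons.prems Cons.IH[of "js @ [i]"]
    by (intro moment_gap_Cons_tendsto scaled_mixed_moment_tendsto) auto
  then show ?case
    using S[of "(js @ [i]) @ is"] S[of "js @ is"] Cons.prems by simp
qed simp

lemma infnorm_perturbed_le:
  "infnorm (perturbed n \<omega>) \<le> (1 + infnorm l + infnorm a) * (infnorm (\<delta> n \<omega>) + 1 / n)"
proof -
  obtain i where i: "infnorm (perturbed n \<omega>) = \<bar>perturbed n \<omega> $ i\<bar>"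
    by (rule infnorm_attained)
  \<comment> \<open>For \<open>n = 0\<close> the quotient is 0 by convention, so the bound holds for
    every \<open>n\<close>.\<close>
  have "\<bar>l $ i\<bar> / n \<le> infnorm l"
    using component_le_infnorm_cart[of l i] infnorm_pos_le[of l]
    by (cases "n = 0") (auto intro!: order_trans[OF divide_left_mono[of 1 "real n" "\<bar>l $ i\<bar>"]])
  then have "\<bar>1 + l $ i / n\<bar> \<le> 1 + infnorm l"
    by (auto intro!: order_trans[OF abs_triangle_ineq])
  then have "\<bar>(1 + l $ i / n) * \<delta> n \<omega> $ i\<bar> \<le> (1 + infnorm l) * infnorm (\<delta> n \<omega>)"
    unfolding abs_mult by (intro mult_mono component_le_infnorm_cart) (auto simp: infnorm_pos_le add_nonneg_nonneg)
  moreover have "\<bar>a $ i / n\<bar> \<le> infnorm a / n"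
    by (simp add: divide_right_mono component_le_infnorm_cart)
  moreover have "perturbed n \<omega> $ i = (1 + l $ i / n) * \<delta> n \<omega> $ i + a $ i / n"
    by (simp add: perturbed_def)
  ultimately have "infnorm (perturbed n \<omega>) \<le> (1 + infnorm l) * infnorm (\<delta> n \<omega>) + infnorm a / n"
    unfolding i by linarith
  moreover have "0 \<le> infnorm a * infnorm (\<delta> n \<omega>)" "0 \<le> (1 + infnorm l) * (1 / n)"
    using infnorm_pos_le[of a] infnorm_pos_le[of l] infnorm_pos_le[of "\<delta> n \<omega>"] by auto
  moreover have "(1 + infnorm l + infnorm a) * (infnorm (\<delta> n \<omega>) + 1 / n) =
      (1 + infnorm l) * infnorm (\<delta> n \<omega>) + infnorm a / n +
      (infnorm a * infnorm (\<delta> n \<omega>) + (1 + infnorm l) * (1 / n))"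
    by (simp add: algebra_simps add_divide_distrib)
  ultimately show ?thesis
    by linarith
qed

section \<open>Taylor expansion in expectation\<close>

context
  fixes f :: "real ^ 'm \<Rightarrow> real" and x :: "real ^ 'm"
  assumes meas: "\<forall>\<^sub>F n in sequentially. \<delta> n \<in> borel_measurable (P n)"
    and fifth_int: "\<forall>\<^sub>F n in sequentially. integrable (P n) (\<lambda>\<omega>. infnorm (\<delta> n \<omega>) ^ 5)"
    and fifth_lim: "(\<lambda>n. (real n)\<^sup>2 * (\<integral>\<omega>. infnorm (\<delta> n \<omega>) ^ 5 \<partial>P n)) \<longlonglongrightarrow> 0"
    and d: "d = 4" and S: "\<And>ks. length ks \<noteq> 2 \<Longrightarrow> S ks = 0"
    and smooth: "times_differentiable 5 f"
    and fifth_deriv: "\<exists>B. \<forall>\<phi>. tensor_max 5 (deriv_tensor f \<phi>) \<le> B"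
    and critical: "\<And>i. deriv_tensor f x [i] = 0"
begin

lemma measurable_perturbed: "\<forall>\<^sub>F n in sequentially. perturbed n \<in> borel_measurable (P n)"
  using meas
proof eventually_elim
  case (elim n)
  have "continuous_on UNIV (\<lambda>v. (\<chi> i. (1 + l $ i / n) * v $ i + a $ i / n) :: real ^ 'm)"
    by (intro continuous_intros)
  from borel_measurable_continuous_on[OF this elim] show ?case
    by (simp add: perturbed_def[abs_def])
qed

text \<open>The perturbed error is at most a constant times the original error plus
  \<open>1 / n\<close>. After scaling, the extra term contributes a multiple of
  \<open>(1 / n) ^ 3\<close>.\<close>

lemma perturbed_fifth_moment:
  shows "\<forall>\<^sub>F n in sequentially. integrable (P n) (\<lambda>\<omega>. infnorm (perturbed n \<omega>) ^ 5)"
    and "(\<lambda>n. (real n)\<^sup>2 * (\<integral>\<omega>. infnorm (perturbed n \<omega>) ^ 5 \<partial>P n)) \<longlonglongrightarrow> 0"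
proof -
  define K where "K = 1 + infnorm l + infnorm a"
  have K: "K \<ge> 0"
    using infnorm_pos_le[of l] infnorm_pos_le[of a] by (simp add: K_def)
  have pow: "infnorm (perturbed n \<omega>) ^ 5 \<le> (2 * K) ^ 5 * (infnorm (\<delta> n \<omega>) ^ 5 + (1 / n) ^ 5)" for n \<omega>
  proof -
    \<comment> \<open>The sum is passed through the maximum to split its fifth power, whence the
      constant \<open>(2 * K) ^ 5\<close>.\<close>
    have max: "u + v \<le> 2 * max u v" "max u v ^ 5 \<le> u ^ 5 + v ^ 5" if "u \<ge> 0" "v \<ge> 0" for u v :: real
      using that by (auto simp: max_def)
    have "infnorm (perturbed n \<omega>) \<le> K * (infnorm (\<delta> n \<omega>) + 1 / n)"
      unfolding K_def by (rule infnorm_perturbed_le)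
    also have "\<dots> \<le> K * (2 * max (infnorm (\<delta> n \<omega>)) (1 / n))"
      using K by (intro mult_left_mono max infnorm_pos_le) auto
    finally have "infnorm (perturbed n \<omega>) ^ 5 \<le> (2 * K * max (infnorm (\<delta> n \<omega>)) (1 / n)) ^ 5"
      by (intro power_mono infnorm_pos_le) (simp add: mult_ac)
    also have "\<dots> = (2 * K) ^ 5 * max (infnorm (\<delta> n \<omega>)) (1 / n) ^ 5"
      by (rule power_mult_distrib)
    also have "\<dots> \<le> (2 * K) ^ 5 * (infnorm (\<delta> n \<omega>) ^ 5 + (1 / n) ^ 5)"
      using K by (intro mult_left_mono max infnorm_pos_le) auto
    finally show ?thesis .
  qed
  have bound: "\<forall>\<^sub>F n in sequentially. n \<ge> 1 \<and> integrable (P n) (\<lambda>\<omega>. infnorm (perturbed n \<omega>) ^ 5) \<and>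
      (\<integral>\<omega>. infnorm (perturbed n \<omega>) ^ 5 \<partial>P n) \<le>
        (2 * K) ^ 5 * ((\<integral>\<omega>. infnorm (\<delta> n \<omega>) ^ 5 \<partial>P n) + (1 / n) ^ 5)"
    using fifth_int measurable_perturbed eventually_ge_at_top[of 1]
  proof eventually_elim
    case (elim n)
    interpret prob_space "P n"
      using elim by (intro prob)
    let ?g = "\<lambda>\<omega>. (2 * K) ^ 5 * (infnorm (\<delta> n \<omega>) ^ 5 + (1 / n) ^ 5)"
    have g: "integrable (P n) ?g"
      using elim by simp
    have "(\<lambda>\<omega>. infnorm (perturbed n \<omega>) ^ 5) \<in> borel_measurable (P n)"
      by (intro borel_measurable_continuous_on[OF _ elim(2)] continuous_intros)
    then have int: "integrable (P n) (\<lambda>\<omega>. infnorm (perturbed n \<omega>) ^ 5)"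
    proof (rule Bochner_Integration.integrable_bound[OF g])
      have "norm (infnorm (perturbed n \<omega>) ^ 5) \<le> norm (?g \<omega>)" for \<omega>
        unfolding real_norm_def abs_of_nonneg[OF zero_le_power[OF infnorm_pos_le]]
        by (rule order_trans[OF pow abs_ge_self])
      then show "AE \<omega> in P n. norm (infnorm (perturbed n \<omega>) ^ 5) \<le> norm (?g \<omega>)"
        by simp
    qed
    have "(\<integral>\<omega>. infnorm (perturbed n \<omega>) ^ 5 \<partial>P n) \<le> (\<integral>\<omega>. ?g \<omega> \<partial>P n)"
      using int g pow by (intro integral_mono)
    also have "\<dots> = (2 * K) ^ 5 * ((\<integral>\<omega>. infnorm (\<delta> n \<omega>) ^ 5 \<partial>P n) + (1 / n) ^ 5)"
      using elim by (simp add: prob_space)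
    finally show ?case
      using int elim by simp
  qed
  then show "\<forall>\<^sub>F n in sequentially. integrable (P n) (\<lambda>\<omega>. infnorm (perturbed n \<omega>) ^ 5)"
    by eventually_elim simp
  have "(\<lambda>n. (2 * K) ^ 5 * ((real n)\<^sup>2 * (\<integral>\<omega>. infnorm (\<delta> n \<omega>) ^ 5 \<partial>P n) + (1 / real n) ^ 3))
      \<longlonglongrightarrow> (2 * K) ^ 5 * (0 + 0 ^ 3)"
    by (intro tendsto_intros fifth_lim lim_1_over_n)
  then have lim0: "(\<lambda>n. (2 * K) ^ 5 * ((real n)\<^sup>2 * (\<integral>\<omega>. infnorm (\<delta> n \<omega>) ^ 5 \<partial>P n) + (1 / real n) ^ 3))
      \<longlonglongrightarrow> 0"
    by simp
  show "(\<lambda>n. (real n)\<^sup>2 * (\<integral>\<omega>. infnorm (perturbed n \<omega>) ^ 5 \<partial>P n)) \<longlonglongrightarrow> 0"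
  proof (rule Lim_null_comparison[OF _ lim0])
    show "\<forall>\<^sub>F n in sequentially. norm ((real n)\<^sup>2 * (\<integral>\<omega>. infnorm (perturbed n \<omega>) ^ 5 \<partial>P n)) \<le>
        (2 * K) ^ 5 * ((real n)\<^sup>2 * (\<integral>\<omega>. infnorm (\<delta> n \<omega>) ^ 5 \<partial>P n) + (1 / real n) ^ 3)"
      using bound
    proof eventually_elim
      case (elim n)
      have "0 \<le> (\<integral>\<omega>. infnorm (perturbed n \<omega>) ^ 5 \<partial>P n)"
        by (simp add: infnorm_pos_le)
      then have "norm ((real n)\<^sup>2 * (\<integral>\<omega>. infnorm (perturbed n \<omega>) ^ 5 \<partial>P n)) \<le>
          (real n)\<^sup>2 * ((2 * K) ^ 5 * ((\<integral>\<omega>. infnorm (\<delta> n \<omega>) ^ 5 \<partial>P n) + (1 / n) ^ 5))"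
        using elim by (simp add: abs_mult mult_left_mono)
      also have "\<dots> = (2 * K) ^ 5 * ((real n)\<^sup>2 * (\<integral>\<omega>. infnorm (\<delta> n \<omega>) ^ 5 \<partial>P n) + (1 / real n) ^ 3)"
        using elim by (simp add: distrib_left mult_ac power_divide eval_nat_numeral)
      finally show ?case .
    qed
  qed
qed

definition Taylor_polynomial :: "real ^ 'm \<Rightarrow> real" where
  "Taylor_polynomial v = (\<Sum>k<5. tensor_inner k (deriv_tensor f x) (tensor_power v) / fact k)"

lemma Taylor_remainder:
  "\<exists>C\<ge>0. \<forall>v. \<bar>f (x + v) - Taylor_polynomial v\<bar> \<le> C * infnorm v ^ 5"
  using fifth_deriv Taylor_deriv_tensor_bound[OF smooth, of _ x] unfolding Taylor_polynomial_def by auto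

text \<open>Continuity makes the remainder measurable when evaluated at a measurable error.\<close>

lemma continuous_on_Taylor_remainder: "continuous_on UNIV (\<lambda>v. f (x + v) - Taylor_polynomial v)"
proof -
  have "f differentiable (at z)" for z
    using smooth[unfolded times_differentiable_def, rule_format, of "[]" z] by simp
  then have "continuous_on UNIV f"
    by (intro differentiable_imp_continuous_on) (simp add: differentiable_on_def)
  then have "continuous_on UNIV (\<lambda>v. f (x + v))"
    by (rule continuous_on_compose2) (auto intro!: continuous_intros)
  then show ?thesis
    unfolding Taylor_polynomial_def tensor_inner_def
    by (intro continuous_intros continuous_on_tensor_power) auto
qed

text \<open>Stated for a general \<open>X\<close> because it is applied to the original and to the
  perturbed error. Domination by the fifth power gives both integrability and decay.\<close>

lemma remainder_moment_tendsto:
  assumes X: "\<forall>\<^sub>F n in sequentially. X n \<in> borel_measurable (P n)"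
    and int_X: "\<forall>\<^sub>F n in sequentially. integrable (P n) (\<lambda>\<omega>. infnorm (X n \<omega>) ^ 5)"
    and lim_X: "(\<lambda>n. (real n)\<^sup>2 * (\<integral>\<omega>. infnorm (X n \<omega>) ^ 5 \<partial>P n)) \<longlonglongrightarrow> 0"
  shows "\<forall>\<^sub>F n in sequentially. integrable (P n) (\<lambda>\<omega>. f (x + X n \<omega>) - Taylor_polynomial (X n \<omega>))"
    and "(\<lambda>n. (real n)\<^sup>2 * (\<integral>\<omega>. f (x + X n \<omega>) - Taylor_polynomial (X n \<omega>) \<partial>P n)) \<longlonglongrightarrow> 0"
proof -
  obtain C where C: "C \<ge> 0" "\<And>v. \<bar>f (x + v) - Taylor_polynomial v\<bar> \<le> C * infnorm v ^ 5"
    using Taylor_remainder by blast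
  let ?r = "\<lambda>n \<omega>. f (x + X n \<omega>) - Taylor_polynomial (X n \<omega>)"
  have bound: "\<forall>\<^sub>F n in sequentially. integrable (P n) (?r n) \<and>
      \<bar>\<integral>\<omega>. ?r n \<omega> \<partial>P n\<bar> \<le> C * (\<integral>\<omega>. infnorm (X n \<omega>) ^ 5 \<partial>P n)"
    using int_X X
  proof eventually_elim
    case (elim n)
    have g: "integrable (P n) (\<lambda>\<omega>. C * infnorm (X n \<omega>) ^ 5)"
      using elim by simp
    have "?r n \<in> borel_measurable (P n)"
      using elim(2) by (rule borel_measurable_continuous_on[OF continuous_on_Taylor_remainder])
    then have r: "integrable (P n) (?r n)"
      using C(2) by (intro Bochner_Integration.integrable_bound[OF g])
        (auto intro!: AE_I2 order_trans[OF C(2)])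
    have "\<bar>\<integral>\<omega>. ?r n \<omega> \<partial>P n\<bar> \<le> (\<integral>\<omega>. C * infnorm (X n \<omega>) ^ 5 \<partial>P n)"
      using r g C(2) by (intro order_trans[OF integral_abs_bound] integral_mono integrable_abs)
    with r show ?case
      by simp
  qed
  then show "\<forall>\<^sub>F n in sequentially. integrable (P n) (?r n)"
    by eventually_elim simp
  have lim0: "(\<lambda>n. C * ((real n)\<^sup>2 * (\<integral>\<omega>. infnorm (X n \<omega>) ^ 5 \<partial>P n))) \<longlonglongrightarrow> 0"
    using tendsto_mult_right_zero[OF lim_X] .
  show "(\<lambda>n. (real n)\<^sup>2 * (\<integral>\<omega>. ?r n \<omega> \<partial>P n)) \<longlonglongrightarrow> 0"
  proof (rule Lim_null_comparison[OF _ lim0])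
    show "\<forall>\<^sub>F n in sequentially. norm ((real n)\<^sup>2 * (\<integral>\<omega>. ?r n \<omega> \<partial>P n)) \<le>
        C * ((real n)\<^sup>2 * (\<integral>\<omega>. infnorm (X n \<omega>) ^ 5 \<partial>P n))"
      using bound
    proof eventually_elim
      case (elim n)
      then have "(real n)\<^sup>2 * \<bar>\<integral>\<omega>. ?r n \<omega> \<partial>P n\<bar> \<le>
          (real n)\<^sup>2 * (C * (\<integral>\<omega>. infnorm (X n \<omega>) ^ 5 \<partial>P n))"
        by (intro mult_left_mono) auto
      then show ?case
        by (simp add: abs_mult mult_ac)
    qed
  qed
qed

lemma integral_Taylor_polynomial:
  assumes int_X: "\<And>is. length is \<le> 4 \<Longrightarrow> integrable M (\<lambda>\<omega>. tensor_power (X \<omega>) is)"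
  shows "integrable M (\<lambda>\<omega>. Taylor_polynomial (X \<omega>))"
    and "(\<integral>\<omega>. Taylor_polynomial (X \<omega>) \<partial>M) =
      (\<Sum>k<5. (\<Sum>is | length is = k. deriv_tensor f x is * (\<integral>\<omega>. tensor_power (X \<omega>) is \<partial>M)) / fact k)"
proof -
  have T: "integrable M (\<lambda>\<omega>. deriv_tensor f x is * tensor_power (X \<omega>) is)"
    if "is \<in> {is. length is = k}" "k < 5" for "is" k
    using int_X[of "is"] that by simp
  then have "integrable M (\<lambda>\<omega>. (\<Sum>is | length is = k. deriv_tensor f x is * tensor_power (X \<omega>) is) / fact k)"
    if "k \<in> {..<5}" for k
    using that by (intro integrable_divide_zero Bochner_Integration.integrable_sum) auto
  then show "integrable M (\<lambda>\<omega>. Taylor_polynomial (X \<omega>))"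
    and "(\<integral>\<omega>. Taylor_polynomial (X \<omega>) \<partial>M) =
      (\<Sum>k<5. (\<Sum>is | length is = k. deriv_tensor f x is * (\<integral>\<omega>. tensor_power (X \<omega>) is \<partial>M)) / fact k)"
    unfolding Taylor_polynomial_def tensor_inner_def
    using T by (auto simp: Bochner_Integration.integral_sum intro!: Bochner_Integration.integrable_sum)
qed

text \<open>The reward is its Taylor polynomial plus the remainder, both integrable. So it is
  integrable itself, and the integrals may be split.\<close>

lemma scaled_increment_decomposition:
  "\<forall>\<^sub>F n in sequentially. integrable (P n) (\<lambda>\<omega>. f (x + perturbed n \<omega>)) \<and>
    integrable (P n) (\<lambda>\<omega>. f (x + \<delta> n \<omega>)) \<and>
    (\<Sum>k<5. (\<Sum>is | length is = k. deriv_tensor f x is * moment_gap n [] is) / fact k) +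
      ((real n)\<^sup>2 * (\<integral>\<omega>. f (x + perturbed n \<omega>) - Taylor_polynomial (perturbed n \<omega>) \<partial>P n) -
       (real n)\<^sup>2 * (\<integral>\<omega>. f (x + \<delta> n \<omega>) - Taylor_polynomial (\<delta> n \<omega>) \<partial>P n)) =
    (real n)\<^sup>2 * ((\<integral>\<omega>. f (x + perturbed n \<omega>) \<partial>P n) - (\<integral>\<omega>. f (x + \<delta> n \<omega>) \<partial>P n))"
  using int remainder_moment_tendsto(1)[OF meas fifth_int fifth_lim]
    remainder_moment_tendsto(1)[OF measurable_perturbed perturbed_fifth_moment]
proof eventually_elim
  case (elim n)
  have \<delta>: "integrable (P n) (\<lambda>\<omega>. tensor_power (\<delta> n \<omega>) is)"
    and p: "integrable (P n) (\<lambda>\<omega>. tensor_power (perturbed n \<omega>) is)" if "length is \<le> 4" for "is"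
    using elim(1) that integrable_mixed_power[of 4 n "[]" "is"] by (auto simp: d)
  note T\<delta> = integral_Taylor_polynomial[where M = "P n" and X = "\<delta> n", simplified \<delta>, simplified]
    and Tp = integral_Taylor_polynomial[where M = "P n" and X = "perturbed n", simplified p, simplified]
  have f\<delta>: "integrable (P n) (\<lambda>\<omega>. f (x + \<delta> n \<omega>))"
    using Bochner_Integration.integrable_add[OF elim(2) T\<delta>(1)] by simp
  have fp: "integrable (P n) (\<lambda>\<omega>. f (x + perturbed n \<omega>))"
    using Bochner_Integration.integrable_add[OF elim(3) Tp(1)] by simp
  have "(\<Sum>k<5. (\<Sum>is | length is = k. deriv_tensor f x is * moment_gap n [] is) / fact k) =
      (real n)\<^sup>2 * ((\<integral>\<omega>. Taylor_polynomial (perturbed n \<omega>) \<partial>P n) - (\<integral>\<omega>. Taylor_polynomial (\<delta> n \<omega>) \<partial>P n))"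
    unfolding T\<delta>(2) Tp(2) moment_gap_def mixed_moment_def
    by (simp add: sum_distrib_left right_diff_distrib sum_subtractf diff_divide_distrib mult_ac
        flip: sum_divide_distrib)
  then show ?case
    using f\<delta> fp T\<delta>(1) Tp(1) by (simp add: Bochner_Integration.integral_diff algebra_simps)
qed

lemma Taylor_term_tendsto:
  "(\<lambda>n. \<Sum>k<5. (\<Sum>is | length is = k. deriv_tensor f x is * moment_gap n [] is) / fact k) \<longlonglongrightarrow>
    (\<Sum>i\<in>UNIV. \<Sum>j\<in>UNIV. deriv_tensor f x [i, j] * ((l $ i + l $ j) * S [i, j] + a $ i * a $ j)) / 2 +
    (\<Sum>i\<in>UNIV. \<Sum>j\<in>UNIV. \<Sum>k\<in>UNIV. deriv_tensor f x [i, j, k] *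
      (a $ i * S [j, k] + a $ j * S [i, k] + a $ k * S [i, j])) / 6"
proof -
  let ?T = "\<lambda>k n. (\<Sum>is | length is = k. deriv_tensor f x is * moment_gap n [] is)"
  have T2: "(\<lambda>n. ?T 2 n) \<longlonglongrightarrow>
      (\<Sum>i\<in>UNIV. \<Sum>j\<in>UNIV. deriv_tensor f x [i, j] * ((l $ i + l $ j) * S [i, j] + a $ i * a $ j))"
    unfolding numeral_2_eq_2 sum_lists_length_Suc using S
    by (auto simp: d intro!: tendsto_sum tendsto_mult moment_gap_2_tendsto)
  have T3: "(\<lambda>n. ?T 3 n) \<longlonglongrightarrow> (\<Sum>i\<in>UNIV. \<Sum>j\<in>UNIV. \<Sum>k\<in>UNIV. deriv_tensor f x [i, j, k] *
      (a $ i * S [j, k] + a $ j * S [i, k] + a $ k * S [i, j]))"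
    unfolding numeral_3_eq_3 sum_lists_length_Suc using S
    by (auto simp: d intro!: tendsto_sum tendsto_mult moment_gap_3_tendsto)
  have "(\<lambda>n. ?T 4 n) \<longlonglongrightarrow> (\<Sum>is | length is = 4. deriv_tensor f x is * 0)"
    using S by (intro tendsto_sum tendsto_mult tendsto_const moment_gap_high_tendsto) (auto simp: d)
  then have T4: "(\<lambda>n. ?T 4 n) \<longlonglongrightarrow> 0"
    by simp
  \<comment> \<open>Order 0 drops out because the empty gap is zero, and order 1 because
    \<open>x\<close> is a critical point.\<close>
  have "(\<Sum>k<5. ?T k n / fact k) = ?T 2 n / 2 + ?T 3 n / 6 + ?T 4 n / 24" for n
    by (simp add: eval_nat_numeral sum_lists_length_Suc critical del: deriv_tensor.simps)
  then show ?thesis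
    using tendsto_add[OF tendsto_add[OF tendsto_divide[OF T2 tendsto_const[of 2]]
      tendsto_divide[OF T3 tendsto_const[of 6]]] tendsto_divide[OF T4 tendsto_const[of 24]]]
    by simp
qed

lemma scaled_increment_tendsto:
  "(\<lambda>n. (real n)\<^sup>2 * ((\<integral>\<omega>. f (x + perturbed n \<omega>) \<partial>P n) - (\<integral>\<omega>. f (x + \<delta> n \<omega>) \<partial>P n))) \<longlonglongrightarrow>
    (\<Sum>i\<in>UNIV. \<Sum>j\<in>UNIV. deriv_tensor f x [i, j] * ((l $ i + l $ j) * S [i, j] + a $ i * a $ j)) / 2 +
    (\<Sum>i\<in>UNIV. \<Sum>j\<in>UNIV. \<Sum>k\<in>UNIV. deriv_tensor f x [i, j, k] *
      (a $ i * S [j, k] + a $ j * S [i, k] + a $ k * S [i, j])) / 6"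
proof (rule Lim_transform_eventually)
  show "(\<lambda>n. (\<Sum>k<5. (\<Sum>is | length is = k. deriv_tensor f x is * moment_gap n [] is) / fact k) +
      ((real n)\<^sup>2 * (\<integral>\<omega>. f (x + perturbed n \<omega>) - Taylor_polynomial (perturbed n \<omega>) \<partial>P n) -
       (real n)\<^sup>2 * (\<integral>\<omega>. f (x + \<delta> n \<omega>) - Taylor_polynomial (\<delta> n \<omega>) \<partial>P n))) \<longlonglongrightarrow>
    (\<Sum>i\<in>UNIV. \<Sum>j\<in>UNIV. deriv_tensor f x [i, j] * ((l $ i + l $ j) * S [i, j] + a $ i * a $ j)) / 2 +
    (\<Sum>i\<in>UNIV. \<Sum>j\<in>UNIV. \<Sum>k\<in>UNIV. deriv_tensor f x [i, j, k] *
      (a $ i * S [j, k] + a $ j * S [i, k] + a $ k * S [i, j])) / 6"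
    using tendsto_add[OF Taylor_term_tendsto tendsto_diff[OF
      remainder_moment_tendsto(2)[OF measurable_perturbed perturbed_fifth_moment]
      remainder_moment_tendsto(2)[OF meas fifth_int fifth_lim]]]
    by simp
qed (rule eventually_mono[OF scaled_increment_decomposition], simp)

end

end

end

subsection \<open>The asymptotic improvement\<close>

text \<open>The limits of the scaled error moments as a family over all index lists: only order 2
  survives.\<close>

definition second_order :: "real ^ 'm ^ 'm \<Rightarrow> 'm tensor" where
  "second_order \<Sigma> is = (case is of [i, j] \<Rightarrow> \<Sigma> $ i $ j | _ \<Rightarrow> 0)"

lemma second_order_simps [simp]:
  "second_order \<Sigma> [i, j] = \<Sigma> $ i $ j"
  "length is \<noteq> 2 \<Longrightarrow> second_order \<Sigma> is = 0"
  by (auto simp: second_order_def split: list.split)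

text \<open>Order 1 vanishes by the bias condition, order 2 is the given limit read entrywise, and
  order \<open>k \<ge> 3\<close> vanishes because \<open>k / 2\<close> exceeds 1. The empty list is
  excluded, its scaled moment being \<open>n\<close>.\<close>

lemma scaled_error_moments_tendsto:
  fixes \<delta> :: "nat \<Rightarrow> 'a \<Rightarrow> real ^ 'm"
  assumes prob: "\<And>n. n \<ge> 1 \<Longrightarrow> prob_space (P n)"
    and meas: "\<And>n. n \<ge> 1 \<Longrightarrow> \<delta> n \<in> borel_measurable (P n)"
    and bias: "(\<lambda>n. infnorm (\<integral>\<omega>. \<delta> n \<omega> \<partial>P n)) \<in> o(\<lambda>n. 1 / real n)"
    and second: "(\<lambda>n. real n *\<^sub>R (\<integral>\<omega>. outer (\<delta> n \<omega>) (\<delta> n \<omega>) \<partial>P n)) \<longlonglongrightarrow> \<Sigma>"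
    and finite: "\<And>k. k \<ge> 3 \<Longrightarrow> \<forall>\<^sub>F n in sequentially. integrable (P n) (\<lambda>\<omega>. infnorm (\<delta> n \<omega>) ^ k)"
    and moments: "\<And>k. k \<ge> 3 \<Longrightarrow>
      (\<lambda>n. \<integral>\<omega>. infnorm (\<delta> n \<omega>) ^ k \<partial>P n) \<in> O(\<lambda>n. real n powr (- real k / 2))"
  shows "\<forall>\<^sub>F n in sequentially. \<forall>is. length is \<le> d \<longrightarrow> integrable (P n) (\<lambda>\<omega>. tensor_power (\<delta> n \<omega>) is)"
    and "is \<noteq> [] \<Longrightarrow>
      (\<lambda>n. real n * (\<integral>\<omega>. tensor_power (\<delta> n \<omega>) is \<partial>P n)) \<longlonglongrightarrow> second_order \<Sigma> is"
proof -
  \<comment> \<open>\<open>d\<close> is rebound so that the fact serves every degree below. Orders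
    under 3 are reached by domination through \<open>max 3 d\<close>.\<close>
  show int: "\<forall>\<^sub>F n in sequentially. \<forall>is. length is \<le> d \<longrightarrow> integrable (P n) (\<lambda>\<omega>. tensor_power (\<delta> n \<omega>) is)" for d
    using finite[of "max 3 d", OF max.cobounded1] eventually_ge_at_top[of 1]
  proof eventually_elim
    case (elim n)
    interpret prob_space "P n"
      using elim by (intro prob)
    show ?case
      using integrable_tensor_power[OF finite_measure_axioms meas[OF elim(2)] elim(1)] by auto
  qed
  assume "is \<noteq> []"
  then consider i where "is = [i]" | i j where "is = [i, j]" | "length is \<ge> 3"
    by (cases "is"; cases "tl is"; cases "tl (tl is)") auto
  then show "(\<lambda>n. real n * (\<integral>\<omega>. tensor_power (\<delta> n \<omega>) is \<partial>P n)) \<longlonglongrightarrow> second_order \<Sigma> is"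
  proof cases
    case (1 i)
    have lim0: "(\<lambda>n. infnorm (\<integral>\<omega>. \<delta> n \<omega> \<partial>P n) / (1 / real n)) \<longlonglongrightarrow> 0"
      using bias by (rule smalloD_tendsto)
    have "\<forall>\<^sub>F n in sequentially. norm (real n * (\<integral>\<omega>. tensor_power (\<delta> n \<omega>) [i] \<partial>P n)) \<le>
        infnorm (\<integral>\<omega>. \<delta> n \<omega> \<partial>P n) / (1 / real n)"
      using int[of 1]
    proof eventually_elim
      case (elim n)
      then have "integrable (P n) (\<lambda>\<omega>. \<delta> n \<omega> $ j)" for j
        by (auto dest: spec[of _ "[j]"])
      then have "integrable (P n) (\<delta> n)"
        by (rule integrable_vec_lambda)
      then have "(\<integral>\<omega>. \<delta> n \<omega> $ i \<partial>P n) = (\<integral>\<omega>. \<delta> n \<omega> \<partial>P n) $ i"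
        by (rule integral_bounded_linear[OF bounded_linear_vec_nth])
      then show ?case
        using component_le_infnorm_cart[of "\<integral>\<omega>. \<delta> n \<omega> \<partial>P n" i]
        by (simp add: abs_mult mult.commute mult_left_mono)
    qed
    from Lim_null_comparison[OF this lim0] show ?thesis
      using 1 by simp
  next
    case (2 i j)
    have "(\<lambda>n. (real n *\<^sub>R (\<integral>\<omega>. outer (\<delta> n \<omega>) (\<delta> n \<omega>) \<partial>P n)) $ i $ j) \<longlonglongrightarrow> \<Sigma> $ i $ j"
      by (intro tendsto_vec_nth second)
    moreover have "\<forall>\<^sub>F n in sequentially. (real n *\<^sub>R (\<integral>\<omega>. outer (\<delta> n \<omega>) (\<delta> n \<omega>) \<partial>P n)) $ i $ j =
        real n * (\<integral>\<omega>. tensor_power (\<delta> n \<omega>) [i, j] \<partial>P n)"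
      using int[of 2]
    proof eventually_elim
      case (elim n)
      \<comment> \<open>A matrix is a vector of rows, so integrability passes from the entries to
        the rows and then to the matrix.\<close>
      have entry: "integrable (P n) (\<lambda>\<omega>. outer (\<delta> n \<omega>) (\<delta> n \<omega>) $ k $ m)" for k m
        using elim[rule_format, of "[k, m]"] by (simp add: outer_def)
      then have row: "integrable (P n) (\<lambda>\<omega>. outer (\<delta> n \<omega>) (\<delta> n \<omega>) $ k)" for k
        by (intro integrable_vec_lambda)
      then have "integrable (P n) (\<lambda>\<omega>. outer (\<delta> n \<omega>) (\<delta> n \<omega>))"
        by (rule integrable_vec_lambda)
      then have "(\<integral>\<omega>. outer (\<delta> n \<omega>) (\<delta> n \<omega>) \<partial>P n) $ i $ j = (\<integral>\<omega>. outer (\<delta> n \<omega>) (\<delta> n \<omega>) $ i $ j \<partial>P n)"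
        using integral_bounded_linear[OF bounded_linear_vec_nth row[of i], of j]
        by (simp add: integral_bounded_linear[OF bounded_linear_vec_nth])
      then show ?case
        by (simp add: outer_def)
    qed
    ultimately show ?thesis
      using 2 by (auto intro: Lim_transform_eventually)
  next
    case 3
    let ?k = "length is"
    have "(\<lambda>n. real n ^ 1 * (\<integral>\<omega>. infnorm (\<delta> n \<omega>) ^ ?k \<partial>P n)) \<longlonglongrightarrow> 0"
      using 3 moments[OF 3] by (intro tendsto_zero_of_bigo_powr[where b = "real ?k / 2"]) auto
    then have lim0: "(\<lambda>n. real n * (\<integral>\<omega>. infnorm (\<delta> n \<omega>) ^ ?k \<partial>P n)) \<longlonglongrightarrow> 0"
      by simp
    have "\<forall>\<^sub>F n in sequentially. norm (real n * (\<integral>\<omega>. tensor_power (\<delta> n \<omega>) is \<partial>P n)) \<le>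
        real n * (\<integral>\<omega>. infnorm (\<delta> n \<omega>) ^ ?k \<partial>P n)"
      using int[of ?k] finite[OF 3]
    proof eventually_elim
      case (elim n)
      then have "\<bar>\<integral>\<omega>. tensor_power (\<delta> n \<omega>) is \<partial>P n\<bar> \<le> (\<integral>\<omega>. infnorm (\<delta> n \<omega>) ^ ?k \<partial>P n)"
        by (intro order_trans[OF integral_abs_bound] integral_mono integrable_abs abs_tensor_power_le) auto
      then show ?case
        by (simp add: abs_mult mult_left_mono)
    qed
    from Lim_null_comparison[OF this lim0] show ?thesis
      using 3 by simp
  qed
qed

section \<open>Identification of the limit\<close>

lemma diag_mult_vec [simp]: "(diag l *v x) $ i = l $ i * x $ i"
  by (simp add: diag_def matrix_vector_mult_def if_distrib[of "\<lambda>u. u * _"] cong: if_cong)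

lemma adjusted_eq_perturbed:
  "adjusted est l n \<omega> = \<theta> + perturbed (\<lambda>n \<omega>. est n \<omega> - \<theta>) l (diag l *v \<theta>) n \<omega>"
proof -
  have "adjusted est l n \<omega> = est n \<omega> + (1 / real n) *\<^sub>R (diag l *v est n \<omega>)"
    by (simp add: adjusted_def matrix_vector_mult_add_rdistrib scaleR_matrix_vector_assoc)
  then show ?thesis
    by (simp add: vec_eq_iff perturbed_def algebra_simps)
qed

text \<open>Symmetry of the third derivative makes the three cubic sums equal to \<open>T\<close>,
  so a sixth of their total is \<open>T / 2\<close>, and \<open>third\<close> rewrites
  \<open>T\<close> with \<open>M\<close>. Symmetry of the Hessian and of \<open>\<Sigma>\<close>
  merges the two sums containing \<open>\<Sigma>\<close>.\<close>

lemma improvement_limit_eq: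
  fixes R :: "real ^ 'm \<Rightarrow> real" and \<theta> l :: "real ^ 'm" and \<Sigma> M :: "real ^ 'm ^ 'm"
  defines "a \<equiv> diag l *v \<theta>"
  assumes smooth: "times_differentiable 5 R"
    and sym: "\<And>i j. \<Sigma> $ i $ j = \<Sigma> $ j $ i"
    and third: "hessian R \<theta> \<bullet> (diag l ** M) = tensor_inner 3 (deriv_tensor R \<theta>) (vec_mat_outer a \<Sigma>)"
  shows "(\<Sum>i\<in>UNIV. \<Sum>j\<in>UNIV. deriv_tensor R \<theta> [i, j] * ((l $ i + l $ j) * \<Sigma> $ i $ j + a $ i * a $ j)) / 2 +
      (\<Sum>i\<in>UNIV. \<Sum>j\<in>UNIV. \<Sum>k\<in>UNIV. deriv_tensor R \<theta> [i, j, k] *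
        (a $ i * \<Sigma> $ j $ k + a $ j * \<Sigma> $ i $ k + a $ k * \<Sigma> $ i $ j)) / 6 =
    1 / 2 * (l \<bullet> (quad_coeff R \<theta> *v l) + lin_coeff R \<theta> \<Sigma> M \<bullet> l)"
proof -
  have a_i: "a $ i = l $ i * \<theta> $ i" for i
    by (simp add: a_def)
  define D where "D = deriv_tensor R \<theta>"
  note swap = deriv_tensor_swap[OF smooth, of _ \<theta>, folded D_def]
  have swap2: "D [i, j] = D [j, i]" and swap3: "D [i, j, k] = D [j, i, k]" for i j k
    by (simp_all add: swap)
  \<comment> \<open>The swap of the inner indices holds at every point, so it may be differentiated
    in direction \<open>i\<close>.\<close>
  have swap3': "D [i, j, k] = D [i, k, j]" for i j k
  proof -
    have "(\<lambda>y. deriv_tensor R y [j, k]) = (\<lambda>y. deriv_tensor R y [k, j])"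
      using deriv_tensor_swap[OF smooth, of "[]"] by (simp add: fun_eq_iff del: deriv_tensor.simps)
    then show ?thesis
      unfolding D_def deriv_tensor.simps(2)[of _ _ i] by simp
  qed
  define T where "T = (\<Sum>i\<in>UNIV. \<Sum>j\<in>UNIV. \<Sum>k\<in>UNIV. D [i, j, k] * (a $ i * \<Sigma> $ j $ k))"
  have T2: "(\<Sum>i\<in>UNIV. \<Sum>j\<in>UNIV. \<Sum>k\<in>UNIV. D [i, j, k] * (a $ j * \<Sigma> $ i $ k)) = T"
    unfolding T_def by (subst sum.swap) (simp add: swap3)
  have "(\<Sum>i\<in>UNIV. \<Sum>j\<in>UNIV. \<Sum>k\<in>UNIV. D [i, j, k] * (a $ k * \<Sigma> $ i $ j)) =
      (\<Sum>i\<in>UNIV. \<Sum>k\<in>UNIV. \<Sum>j\<in>UNIV. D [i, k, j] * (a $ k * \<Sigma> $ i $ j))"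
    by (subst (2) sum.swap) (simp add: swap3')
  then have T3: "(\<Sum>i\<in>UNIV. \<Sum>j\<in>UNIV. \<Sum>k\<in>UNIV. D [i, j, k] * (a $ k * \<Sigma> $ i $ j)) = T"
    using T2 by simp
  have "T = tensor_inner 3 D (vec_mat_outer a \<Sigma>)"
    by (simp add: T_def tensor_inner_def numeral_3_eq_3 sum_lists_length_Suc vec_mat_outer_def)
  also have "\<dots> = hessian R \<theta> \<bullet> (diag l ** M)"
    using third by (simp add: D_def)
  also have "\<dots> = (\<Sum>i\<in>UNIV. \<Sum>j\<in>UNIV. D [i, j] * (l $ i * M $ i $ j))"
    by (simp add: inner_vec_def hessian_def D_def matrix_matrix_mult_def diag_def
        if_distrib[of "\<lambda>u. u * _"] cong: if_cong del: deriv_tensor.simps)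
  finally have T: "T = (\<Sum>i\<in>UNIV. \<Sum>j\<in>UNIV. D [i, j] * (l $ i * M $ i $ j))" .
  have quad: "l \<bullet> (quad_coeff R \<theta> *v l) = (\<Sum>i\<in>UNIV. \<Sum>j\<in>UNIV. D [i, j] * (a $ i * a $ j))"
    by (simp add: inner_vec_def quad_coeff_def hessian_def matrix_vector_mult_def a_i
        sum_distrib_left mult_ac flip: D_def del: deriv_tensor.simps)
  have lin: "lin_coeff R \<theta> \<Sigma> M \<bullet> l =
      (\<Sum>i\<in>UNIV. \<Sum>j\<in>UNIV. D [i, j] * (2 * (l $ i * \<Sigma> $ i $ j) + l $ i * M $ i $ j))"
    by (simp add: inner_vec_def lin_coeff_def hessian_def matrix_vector_mult_def
        sum_distrib_left algebra_simps flip: D_def del: deriv_tensor.simps)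
  have S: "(\<Sum>i\<in>UNIV. \<Sum>j\<in>UNIV. D [i, j] * (l $ j * \<Sigma> $ i $ j)) =
      (\<Sum>i\<in>UNIV. \<Sum>j\<in>UNIV. D [i, j] * (l $ i * \<Sigma> $ i $ j))"
    by (subst sum.swap) (simp add: swap2 sym)
  have "(\<Sum>i\<in>UNIV. \<Sum>j\<in>UNIV. D [i, j] * ((l $ i + l $ j) * \<Sigma> $ i $ j + a $ i * a $ j)) / 2 +
      (\<Sum>i\<in>UNIV. \<Sum>j\<in>UNIV. \<Sum>k\<in>UNIV. D [i, j, k] *
        (a $ i * \<Sigma> $ j $ k + a $ j * \<Sigma> $ i $ k + a $ k * \<Sigma> $ i $ j)) / 6 =
    (\<Sum>i\<in>UNIV. \<Sum>j\<in>UNIV. D [i, j] * (l $ i * \<Sigma> $ i $ j)) +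
    (\<Sum>i\<in>UNIV. \<Sum>j\<in>UNIV. D [i, j] * (a $ i * a $ j)) / 2 + T / 2"
    by (simp add: distrib_left distrib_right sum.distrib S T2 T3 flip: T_def)
  also have "\<dots> = 1 / 2 * (l \<bullet> (quad_coeff R \<theta> *v l) + lin_coeff R \<theta> \<Sigma> M \<bullet> l)"
    unfolding T quad lin by (simp add: sum_distrib_left sum_divide_distrib distrib_left sum.distrib mult_ac)
  finally show ?thesis
    by (simp add: D_def del: deriv_tensor.simps)
qed

theorem proposition4:
  fixes \<theta> :: "real ^ 'm"
    and P :: "nat \<Rightarrow> 'a measure"
    and est :: "nat \<Rightarrow> 'a \<Rightarrow> real ^ 'm"
    and R :: "real ^ 'm \<Rightarrow> real"
    and \<Sigma> M :: "real ^ 'm ^ 'm"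
  assumes prob: "\<And>n. n \<ge> 1 \<Longrightarrow> prob_space (P n)"
    and meas: "\<And>n. n \<ge> 1 \<Longrightarrow> est n \<in> borel_measurable (P n)"
    and bias: "(\<lambda>n. infnorm (\<integral>\<omega>. est n \<omega> - \<theta> \<partial>P n)) \<in> o(\<lambda>n. 1 / real n)"
    and second: "(\<lambda>n. real n *\<^sub>R (\<integral>\<omega>. outer (est n \<omega> - \<theta>) (est n \<omega> - \<theta>) \<partial>P n)) \<longlonglongrightarrow> \<Sigma>"
    and moments_finite: "\<And>k. k \<ge> 3 \<Longrightarrow> \<forall>\<^sub>F n in sequentially.
           integrable (P n) (\<lambda>\<omega>. tensor_max k (tensor_power (est n \<omega> - \<theta>)))"
    and moments: "\<And>k. k \<ge> 3 \<Longrightarrow>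
           (\<lambda>n. \<integral>\<omega>. tensor_max k (tensor_power (est n \<omega> - \<theta>)) \<partial>P n)
             \<in> O(\<lambda>n. real n powr (- real k / 2))"
    and gradient: "GDERIV R \<theta> :> 0"
    and third: "\<And>\<mu>. hessian R \<theta> \<bullet> (diag \<mu> ** M) =
           tensor_inner 3 (deriv_tensor R \<theta>) (vec_mat_outer (diag \<mu> *v \<theta>) \<Sigma>)"
    and smooth: "times_differentiable 5 R"
    and fifth: "\<exists>B. \<forall>\<phi>. tensor_max 5 (deriv_tensor R \<phi>) \<le> B"
  shows "(\<forall>l. (\<forall>\<^sub>F n in sequentially.
                integrable (P n) (\<lambda>\<omega>. R (adjusted est l n \<omega>)) \<and>
                integrable (P n) (\<lambda>\<omega>. R (est n \<omega>))) \<and>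
              scaled_improvement P est R l \<longlonglongrightarrow>
                1 / 2 * (l \<bullet> (quad_coeff R \<theta> *v l) + lin_coeff R \<theta> \<Sigma> M \<bullet> l)) \<and>
         (negative_definite (quad_coeff R \<theta>) \<longrightarrow>
            invertible (quad_coeff R \<theta>) \<and>
            (\<forall>l. is_arg_max (asymptotic_improvement P est R) (\<lambda>_. True) l \<longleftrightarrow>
                 l = - (1 / 2) *\<^sub>R (matrix_inv (quad_coeff R \<theta>) *v lin_coeff R \<theta> \<Sigma> M)))"
proof -
  define \<delta> where "\<delta> n \<omega> = est n \<omega> - \<theta>" for n \<omega>
  have meas': "\<delta> n \<in> borel_measurable (P n)" if "n \<ge> 1" for n
    unfolding \<delta>_def[abs_def] using meas[OF that] by simp
  have fin: "\<forall>\<^sub>F n in sequentially. integrable (P n) (\<lambda>\<omega>. infnorm (\<delta> n \<omega>) ^ k)"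
    and mom: "(\<lambda>n. \<integral>\<omega>. infnorm (\<delta> n \<omega>) ^ k \<partial>P n) \<in> O(\<lambda>n. real n powr (- real k / 2))" if "k \<ge> 3" for k
    using moments_finite[OF that] moments[OF that] by (simp_all add: tensor_max_tensor_power \<delta>_def)
  have int: "\<forall>\<^sub>F n in sequentially. \<forall>is. length is \<le> 4 \<longrightarrow> integrable (P n) (\<lambda>\<omega>. tensor_power (\<delta> n \<omega>) is)"
    and lim: "is \<noteq> [] \<Longrightarrow> (\<lambda>n. real n * (\<integral>\<omega>. tensor_power (\<delta> n \<omega>) is \<partial>P n)) \<longlonglongrightarrow> second_order \<Sigma> is" for "is"
    by (rule scaled_error_moments_tendsto[OF prob meas' bias[folded \<delta>_def] second[folded \<delta>_def] fin mom]; assumption)+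
  have fifth_lim: "(\<lambda>n. (real n)\<^sup>2 * (\<integral>\<omega>. infnorm (\<delta> n \<omega>) ^ 5 \<partial>P n)) \<longlonglongrightarrow> 0"
    using mom[of 5] by (intro tendsto_zero_of_bigo_powr[where b = "5 / 2"]) auto
  \<comment> \<open>The moments for \<open>[i, j]\<close> and \<open>[j, i]\<close> coincide for
    every \<open>n\<close>, hence so do their limits.\<close>
  have sym: "\<Sigma> $ i $ j = \<Sigma> $ j $ i" for i j
    using LIMSEQ_unique[OF lim[of "[i, j]"], of "second_order \<Sigma> [j, i]"] lim[of "[j, i]"]
    by (simp add: mult.commute)
  have critical: "deriv_tensor R \<theta> [i] = 0" for i
    using fun_cong[OF frechet_derivative_at[OF gradient[unfolded gderiv_def]], of "axis i 1"] by simp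
  have improvement: "(\<forall>\<^sub>F n in sequentially.
        integrable (P n) (\<lambda>\<omega>. R (adjusted est l n \<omega>)) \<and> integrable (P n) (\<lambda>\<omega>. R (est n \<omega>))) \<and>
      scaled_improvement P est R l \<longlonglongrightarrow>
        1 / 2 * (l \<bullet> (quad_coeff R \<theta> *v l) + lin_coeff R \<theta> \<Sigma> M \<bullet> l)" for l
  proof -
    define a where "a = diag l *v \<theta>"
    have adj: "R (adjusted est l n \<omega>) = R (\<theta> + perturbed \<delta> l a n \<omega>)" and est: "R (est n \<omega>) = R (\<theta> + \<delta> n \<omega>)" for n \<omega>
      using adjusted_eq_perturbed[of est l n \<omega> \<theta>] by (simp_all add: a_def \<delta>_def[abs_def])
    have "\<forall>\<^sub>F n in sequentially. \<delta> n \<in> borel_measurable (P n)"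
      using eventually_ge_at_top[of 1] by eventually_elim (rule meas')
    \<comment> \<open>\<open>refl\<close> fixes the degree \<open>d\<close> at 4. The placeholder
      stands for the vanishing of \<open>second_order \<Sigma>\<close> outside order 2, which is
      left to simplification.\<close>
    note asms = prob int lim this fin[of 5, simplified] fifth_lim refl _ smooth fifth critical
    have decomposition: "\<forall>\<^sub>F n in sequentially. integrable (P n) (\<lambda>\<omega>. R (\<theta> + perturbed \<delta> l a n \<omega>)) \<and>
        integrable (P n) (\<lambda>\<omega>. R (\<theta> + \<delta> n \<omega>))"
      using scaled_increment_decomposition[OF asms, of l a] by (auto elim: eventually_mono)
    have "scaled_improvement P est R l \<longlonglongrightarrow>
        (\<Sum>i\<in>UNIV. \<Sum>j\<in>UNIV. deriv_tensor R \<theta> [i, j] * ((l $ i + l $ j) * \<Sigma> $ i $ j + a $ i * a $ j)) / 2 +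
        (\<Sum>i\<in>UNIV. \<Sum>j\<in>UNIV. \<Sum>k\<in>UNIV. deriv_tensor R \<theta> [i, j, k] *
          (a $ i * \<Sigma> $ j $ k + a $ j * \<Sigma> $ i $ k + a $ k * \<Sigma> $ i $ j)) / 6"
      using scaled_increment_tendsto[OF asms, of l a]
      by (simp add: scaled_improvement_def[abs_def] adj est del: deriv_tensor.simps)
    then show ?thesis
      using decomposition unfolding a_def improvement_limit_eq[OF smooth sym third]
      by (simp add: adj est a_def)
  qed
  then have "asymptotic_improvement P est R =
      (\<lambda>l. 1 / 2 * (l \<bullet> (quad_coeff R \<theta> *v l) + lin_coeff R \<theta> \<Sigma> M \<bullet> l))"
    unfolding asymptotic_improvement_def by (intro ext limI) blast
  \<comment> \<open>\<open>negative_definite\<close> does not include symmetry, which completing the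
    square requires; it is inherited from the Hessian.\<close>
  moreover have "transpose (quad_coeff R \<theta>) = quad_coeff R \<theta>"
    using deriv_tensor_swap[OF smooth, of "[]" \<theta>]
    by (simp add: vec_eq_iff transpose_def quad_coeff_def hessian_def mult_ac del: deriv_tensor.simps)
  ultimately show ?thesis
    using improvement negative_definite_quadratic_arg_max[of "quad_coeff R \<theta>"] by simp
qed

end
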